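(* For every pair of coprime integers $a,c$ with $c>0$, the open disc bounded by the Ford circle at $\frac{a}{c}$ (the circle in the upper half plane with center $\frac{a}{c}+\frac{1}{2c^2}i$ and radius $\frac{1}{2c^2}$) contains exactly one zero of $E_2$, and this zero is simple. Moreover $E_2$ has no zeros in the upper half plane $\mathbb{H}=\{\tau\in\mathbb{C}:\mathrm{Im}\,\tau>0\}$ other than these. Finally, the zero $\tau$ in the Ford circle at $\frac{a}{c}$ satisfies $$0.000075\,\frac{1}{c^2}<\left|\tau-\frac{a}{c}-\frac{\pi}{6c^2}i\right|<0.0000777\,\frac{1}{c^2}.$$
   Context: $E_2$ denotes the weight 2 Eisenstein series on the upper half plane, $E_2(\tau)=1-24\sum_{n\ge1}\sigma(n)q^n=1-24\sum_{n\ge1}\frac{nq^n}{1-q^n}$ with $q=e^{2\pi i\tau}$ and $\sigma(n)$ the sum of divisors of $n$. *)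

theory Defs
  imports "HOL-Complex_Analysis.Complex_Analysis"
begin

definition divisor_sigma :: "nat \<Rightarrow> nat" where
  "divisor_sigma n = \<Sum>{d. d dvd n}"

text \<open>The Fourier series of the weight 2 Eisenstein series, with the index shifted so that the
  sum over \<open>n \<ge> 1\<close> becomes a sum over all naturals. The series converges exactly on the open
  upper half plane; elsewhere the value carries no meaning.\<close>

definition eisenstein_E2 :: "complex \<Rightarrow> complex" where
  "eisenstein_E2 \<tau> =
     1 - 24 * (\<Sum>n. of_nat (divisor_sigma (Suc n)) * exp (2 * of_real pi * \<i> * \<tau>) ^ Suc n)"

definition ford_disc :: "int \<Rightarrow> int \<Rightarrow> complex set" where
  "ford_disc a c =
     ball (of_int a / of_int c + 1 / (2 * of_int c ^ 2) * \<i>) (1 / (2 * real_of_int c ^ 2))"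

definition simple_zero :: "(complex \<Rightarrow> complex) \<Rightarrow> complex \<Rightarrow> bool" where
  "simple_zero f z \<longleftrightarrow> f z = 0 \<and> f analytic_on {z} \<and> zorder f z = 1"

end

theory Submission
  imports Defs
begin

text \<open>The quasimodular transformation law comes from comparing the two orders of summation of
  \<open>\<Sum> 1 / (m \<tau> + n)\<^sup>2\<close>: subtracting the telescoping terms \<open>1 / (m \<tau> + n) - 1 / (m \<tau> + n + 1)\<close> makes
  the double series absolutely convergent, and the telescoping terms alone produce the anomaly.
  In the coordinate \<open>w\<close> with \<open>\<tau> = a/c - 1/(c\<^sup>2 w)\<close> the Ford disc at \<open>a/c\<close> is the half plane \<open>Im w > 1\<close>,
  and by the transformation law \<open>E\<^sub>2(\<tau>) = 0\<close> becomes the fixed point equation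
  \<open>w = 6i / (\<pi> E\<^sub>2(w - d/c))\<close>. As \<open>E\<^sub>2\<close> is close to \<open>1\<close> where \<open>Im\<close> is large, the right-hand side is a
  contraction with values near \<open>6i/\<pi>\<close>, which gives the unique zero and its location. Reduction
  theory gives every \<open>\<tau>\<close> with \<open>Im \<tau> < \<surd>3/2\<close> a coordinate \<open>w\<close> with \<open>Im w \<ge> \<surd>3/2\<close>
  (rounded to \<open>17/20\<close> below), and there a solution automatically satisfies \<open>Im w > 1\<close>.\<close>

section \<open>Series over the integers and lattice sums\<close>

text \<open>The subtracted telescoping terms sum to 0 along each row (fixed m). Summed over m first,
  on a strip -N <= n < N, they collapse to a cotangent at N/tau, and N -> infinity leaves -2 pi i /
  tau. The columns of the original series are therefore compared only through the windows -N <= n <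
  N. The thresholds form a chain. Im w >= 17/20 gives |E_2 - 1| <= 1/5, which forces Im w >= 7/5 for
  any solution. Since 7/5 > 1 the solution lies in the Ford disc, and on Im w >= 7/5 the derivative
  of E_2 is small enough both for the contraction and for simplicity of the zero. The two decimals
  bracket 4 pi exp(-12) = 0.0000772...: solving the fixed point equation for 1/w shows that the
  distance in question is pi/(6 c^2) times |E_2(w - d/c) - 1|, which is about 4 pi |q| / c^2, where
  |q| = exp(-2 pi Im w) and Im w is close to 6/pi.\<close>

lemma has_sum_int_halves:
  fixes f :: "int \<Rightarrow> complex"
  assumes "((\<lambda>n. f (int n)) has_sum a) UNIV" "((\<lambda>n. f (- int (Suc n))) has_sum b) UNIV"
  shows "(f has_sum (a + b)) UNIV"
proof -
  have "(f has_sum a) (range int)"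
    using assms(1) by (subst has_sum_reindex) (auto simp: o_def inj_on_def)
  moreover have "(f has_sum b) (range (\<lambda>n. - int (Suc n)))"
    using assms(2) by (subst has_sum_reindex) (auto simp: o_def inj_on_def)
  moreover have "range int \<inter> range (\<lambda>n. - int (Suc n)) = {}" by auto
  moreover have "range int \<union> range (\<lambda>n. - int (Suc n)) = UNIV"
  proof -
    have "x \<in> range int \<union> range (\<lambda>n. - int (Suc n))" for x
      by (cases x rule: int_cases) auto
    thus ?thesis by blast
  qed
  ultimately show ?thesis using has_sum_Un_disjoint by metis
qed

lemma has_sum_nonzero_int_halves:
  fixes f :: "int \<Rightarrow> complex"
  assumes "((\<lambda>n. f (int (Suc n))) has_sum a) UNIV" "((\<lambda>n. f (- int (Suc n))) has_sum b) UNIV"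
  shows "(f has_sum (a + b)) (- {0})"
proof -
  have "(f has_sum a) (range (\<lambda>n. int (Suc n)))"
    using assms(1) by (subst has_sum_reindex) (auto simp: o_def inj_on_def)
  moreover have "(f has_sum b) (range (\<lambda>n. - int (Suc n)))"
    using assms(2) by (subst has_sum_reindex) (auto simp: o_def inj_on_def)
  moreover have "range (\<lambda>n. int (Suc n)) \<inter> range (\<lambda>n. - int (Suc n)) = {}" by auto
  moreover have "range (\<lambda>n. int (Suc n)) \<union> range (\<lambda>n. - int (Suc n)) = - {0}"
  proof -
    have "x \<in> range (\<lambda>n. int (Suc n)) \<union> range (\<lambda>n. - int (Suc n))" if "x \<noteq> 0" for x
    proof (cases "x > 0")
      case True
      hence "x = int (Suc (nat (x - 1)))" by simp
      thus ?thesis by blast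
    next
      case False
      hence "x = - int (Suc (nat (- x - 1)))" using that by simp
      thus ?thesis by blast
    qed
    thus ?thesis by auto
  qed
  ultimately show ?thesis using has_sum_Un_disjoint by metis
qed

text \<open>The window is half-open so that a sum of differences \<open>f n - f (n + 1)\<close> over
  it leaves exactly the terms at -N and N.\<close>

lemma has_sum_int_imp_LIMSEQ:
  fixes f :: "int \<Rightarrow> complex"
  assumes "(f has_sum S) UNIV"
  shows "(\<lambda>N. \<Sum>n\<in>{-int N..<int N}. f n) \<longlonglongrightarrow> S"
proof -
  have "filterlim (\<lambda>N. {-int N..<int N}) (finite_subsets_at_top UNIV) sequentially"
    unfolding filterlim_finite_subsets_at_top
  proof safe
    fix X :: "int set" assume "finite X"
    then obtain B where B: "\<And>x. x \<in> X \<Longrightarrow> \<bar>x\<bar> \<le> B"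
      by (metis Max_ge finite_imageI imageI)
    show "\<forall>\<^sub>F N in sequentially. finite {-int N..<int N} \<and> X \<subseteq> {-int N..<int N} \<and> {-int N..<int N} \<subseteq> UNIV"
      using eventually_gt_at_top[of "nat B"]
      by eventually_elim (use B in fastforce)
  qed
  from filterlim_compose[OF assms[unfolded has_sum_def] this] show ?thesis .
qed

lemma summable_on_int_powr:
  assumes "s > 1"
  shows "(\<lambda>n::int. (1 + \<bar>real_of_int n\<bar>) powr (-s)) summable_on UNIV"
proof -
  define f where "f = (\<lambda>n::int. (1 + \<bar>real_of_int n\<bar>) powr (-s))"
  have sm: "summable (\<lambda>n. real n powr (-s))"
    using assms by (subst summable_real_powr_iff) auto
  have 1: "(\<lambda>n. f (int n)) summable_on UNIV"
  proof (rule summable_nonneg_imp_summable_on)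
    have "summable (\<lambda>n. real (Suc n) powr (-s))" using sm by (subst summable_Suc_iff)
    thus "summable (\<lambda>n. f (int n))" by (simp add: f_def)
  qed (auto simp: f_def)
  have 2: "(\<lambda>n. f (- int (Suc n))) summable_on UNIV"
  proof (rule summable_nonneg_imp_summable_on)
    have "summable (\<lambda>n. real (Suc (Suc n)) powr (-s))" using sm by (subst summable_Suc_iff)+
    thus "summable (\<lambda>n. f (- int (Suc n)))" by (simp add: f_def add_ac)
  qed (auto simp: f_def)
  \<comment> \<open>\<open>has_sum_int_halves\<close> is stated for complex values, so the real
    series is lifted to the complex numbers and brought back afterwards.\<close>
  have "((\<lambda>n. complex_of_real (f n)) has_sum
      (of_real (infsum (\<lambda>n. f (int n)) UNIV) + of_real (infsum (\<lambda>n. f (- int (Suc n))) UNIV))) UNIV"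
    using 1 2 by (intro has_sum_int_halves has_sum_of_real) auto
  thus ?thesis unfolding f_def[symmetric]
    by (metis has_sum_of_real_iff of_real_add has_sum_imp_summable)
qed

text \<open>As 1 and \<tau> form a real basis of the plane, the l1 norm of the coordinates is
  controlled by the modulus: the imaginary part controls m, and subtracting m \<tau> then controls
  n.\<close>

lemma lattice_norm_lower_bound:
  fixes \<tau> :: complex
  assumes "Im \<tau> \<noteq> 0"
  obtains \<delta> where "\<delta> > 0" "\<And>m n :: real. cmod (of_real m * \<tau> + of_real n) \<ge> \<delta> * (\<bar>m\<bar> + \<bar>n\<bar>)"
proof -
  define y where "y = \<bar>Im \<tau>\<bar>"
  have y: "y > 0" using assms by (simp add: y_def)
  define C where "C = 1 / y + 1 + cmod \<tau> / y"
  have C: "C > 0" using y unfolding C_def by (intro add_pos_nonneg add_pos_pos) auto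
  have "\<bar>m\<bar> + \<bar>n\<bar> \<le> C * cmod (of_real m * \<tau> + of_real n)" for m n :: real
  proof -
    define w where "w = of_real m * \<tau> + of_real n"
    have "\<bar>m\<bar> * y = \<bar>Im w\<bar>" by (simp add: w_def y_def abs_mult)
    also have "\<dots> \<le> cmod w" by (rule abs_Im_le_cmod)
    finally have m: "\<bar>m\<bar> \<le> cmod w / y" using y by (simp add: field_simps)
    have "\<bar>n\<bar> = cmod (w - of_real m * \<tau>)" by (simp add: w_def)
    also have "\<dots> \<le> cmod w + \<bar>m\<bar> * cmod \<tau>"
      using norm_triangle_ineq4[of w "of_real m * \<tau>"] by (simp add: norm_mult)
    also have "\<dots> \<le> cmod w + cmod w / y * cmod \<tau>"
      using m by (intro add_left_mono mult_right_mono) auto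
    finally have "\<bar>m\<bar> + \<bar>n\<bar> \<le> cmod w / y + (cmod w + cmod w / y * cmod \<tau>)" using m by linarith
    also have "\<dots> = C * cmod w" by (simp add: C_def algebra_simps)
    finally show ?thesis by (simp add: w_def)
  qed
  hence "cmod (of_real m * \<tau> + of_real n) \<ge> 1 / C * (\<bar>m\<bar> + \<bar>n\<bar>)" for m n :: real
    using C by (simp add: field_simps)
  thus ?thesis using that[of "1/C"] C by simp
qed

section \<open>Squared cosecant and cotangent as closed forms of sums over the integers\<close>

definition csc2 :: "complex \<Rightarrow> complex" where
  "csc2 z = (of_real pi / sin (of_real pi * z))\<^sup>2"

lemma sin_pi_nonzero:
  assumes "Im z \<noteq> 0"
  shows "sin (complex_of_real pi * z) \<noteq> 0"
proof
  assume "sin (complex_of_real pi * z) = 0"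
  then obtain n :: int where "complex_of_real pi * z = of_real (n * pi)"
    by (auto simp: sin_eq_0)
  hence "Im (complex_of_real pi * z) = 0" by (metis Im_complex_of_real)
  thus False using assms by simp
qed

lemma not_nonpos_Int_if_Im: "Im z \<noteq> 0 \<Longrightarrow> z \<notin> \<int>\<^sub>\<le>\<^sub>0"
  by (auto elim!: nonpos_Ints_cases)

text \<open>This is the logarithmic derivative of Euler's reflection formula: both sides of Gamma z
  Gamma (1 - z) = pi / sin (pi z) are differentiated and the common nonzero factor is
  cancelled.\<close>

lemma Digamma_reflection:
  assumes z: "Im z \<noteq> 0"
  shows "Digamma z - Digamma (1 - z) = - of_real pi * cot (of_real pi * z)"
proof -
  have z': "Im (1 - z) \<noteq> 0" using z by simp
  note nz = not_nonpos_Int_if_Im[OF z] not_nonpos_Int_if_Im[OF z']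
  have s: "sin (complex_of_real pi * z) \<noteq> 0" by (rule sin_pi_nonzero[OF z])
  have "((\<lambda>z. Gamma z * Gamma (1 - z)) has_field_derivative
           (Gamma z * Digamma z * Gamma (1 - z) - Gamma z * (Gamma (1 - z) * Digamma (1 - z)))) (at z)"
    using nz by (auto intro!: derivative_eq_intros simp: algebra_simps)
  moreover have "((\<lambda>z. Gamma z * Gamma (1 - z)) has_field_derivative
           (- (of_real pi * (of_real pi * cos (of_real pi * z))) / (sin (of_real pi * z))\<^sup>2)) (at z)"
    unfolding Gamma_reflection_complex using s
    by (auto intro!: derivative_eq_intros simp: power2_eq_square divide_simps)
  ultimately have "Gamma z * Digamma z * Gamma (1 - z) - Gamma z * (Gamma (1 - z) * Digamma (1 - z))
     = - (of_real pi * (of_real pi * cos (of_real pi * z))) / (sin (of_real pi * z))\<^sup>2"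
    by (rule DERIV_unique)
  also have "Gamma z * Digamma z * Gamma (1 - z) - Gamma z * (Gamma (1 - z) * Digamma (1 - z)) =
      (Gamma z * Gamma (1 - z)) * (Digamma z - Digamma (1 - z))" by (simp add: algebra_simps)
  also have "Gamma z * Gamma (1 - z) = of_real pi / sin (of_real pi * z)"
    by (rule Gamma_reflection_complex)
  finally have *: "of_real pi / sin (of_real pi * z) * (Digamma z - Digamma (1 - z)) =
      of_real pi / sin (of_real pi * z) * (- of_real pi * cot (of_real pi * z))"
    by (simp add: cot_def power2_eq_square)
  have "complex_of_real pi / sin (of_real pi * z) \<noteq> 0" using s by simp
  with * show ?thesis using mult_left_cancel by blast
qed

text \<open>\<open>Digamma_reflection\<close> holds on the open set Im z \<noteq> 0, so it may be
  differentiated there; the inner derivative of 1 - z turns the difference into a sum.\<close>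

lemma Polygamma_1_reflection:
  assumes z: "Im z \<noteq> 0"
  shows "Polygamma 1 z + Polygamma 1 (1 - z) = csc2 z"
proof -
  have z': "Im (1 - z) \<noteq> 0" using z by simp
  note nz = not_nonpos_Int_if_Im[OF z] not_nonpos_Int_if_Im[OF z']
  have s: "sin (complex_of_real pi * z) \<noteq> 0" by (rule sin_pi_nonzero[OF z])
  define S where "S = {z. Im z \<noteq> 0}"
  have S: "open S" "z \<in> S"
    using z by (auto simp: S_def intro!: open_Collect_neq continuous_intros)
  have "((\<lambda>z. Digamma z - Digamma (1 - z)) has_field_derivative
          (Polygamma (Suc 0) z + Polygamma (Suc 0) (1 - z))) (at z)"
    using nz by (auto intro!: derivative_eq_intros)
  moreover have "((\<lambda>z. - of_real pi * cot (of_real pi * z)) has_field_derivative csc2 z) (at z)"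
  proof -
    let ?s = "sin (complex_of_real pi * z)" and ?c = "cos (complex_of_real pi * z)"
    have "((\<lambda>z. - of_real pi * (cos (of_real pi * z) / sin (of_real pi * z))) has_field_derivative
            - of_real pi * ((- ?s * of_real pi * ?s - ?c * (?c * of_real pi)) / (?s * ?s))) (at z)"
      using s by (intro derivative_eq_intros refl | simp)+
    also have "- ?s * of_real pi * ?s - ?c * (?c * of_real pi) = - (?s\<^sup>2 + ?c\<^sup>2) * of_real pi"
      by algebra
    also have "- of_real pi * (- (?s\<^sup>2 + ?c\<^sup>2) * of_real pi / (?s * ?s)) = csc2 z"
      by (simp add: csc2_def power2_eq_square del: power_divide flip: power2_eq_square)
         (simp add: power2_eq_square)
    finally show ?thesis unfolding cot_def .
  qed
  hence "((\<lambda>z. Digamma z - Digamma (1 - z)) has_field_derivative csc2 z) (at z)"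
    by (rule DERIV_cong_ev[THEN iffD1, rotated -1])
       (use S in \<open>auto simp: S_def Digamma_reflection eventually_nhds intro!: exI[of _ S]\<close>)
  ultimately show ?thesis using DERIV_unique by fastforce
qed

lemma abs_summable_inverse_square_int:
  assumes "Im z \<noteq> 0"
  shows "(\<lambda>n::int. norm (1 / (z + of_int n)\<^sup>2)) summable_on UNIV"
proof -
  obtain \<delta> where \<delta>: "\<delta> > 0" "\<And>m n :: real. cmod (of_real m * z + of_real n) \<ge> \<delta> * (\<bar>m\<bar> + \<bar>n\<bar>)"
    using lattice_norm_lower_bound[OF assms] by blast
  have "(\<lambda>n::int. (1 / \<delta>\<^sup>2) * (1 + \<bar>real_of_int n\<bar>) powr (-2)) summable_on UNIV"
    by (intro summable_on_cmult_right summable_on_int_powr) auto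
  thus ?thesis
  proof (rule Infinite_Sum.abs_summable_on_comparison_test')
    fix n :: int
    have "\<delta> * (1 + \<bar>real_of_int n\<bar>) \<le> cmod (z + of_int n)" using \<delta>(2)[of 1 "of_int n"] by simp
    hence "(\<delta> * (1 + \<bar>real_of_int n\<bar>))\<^sup>2 \<le> (cmod (z + of_int n))\<^sup>2"
      using \<delta>(1) by (intro power_mono) auto
    moreover have "0 < (\<delta> * (1 + \<bar>real_of_int n\<bar>))\<^sup>2" using \<delta>(1) by auto
    ultimately have "1 / (cmod (z + of_int n))\<^sup>2 \<le> 1 / (\<delta> * (1 + \<bar>real_of_int n\<bar>))\<^sup>2"
      by (intro divide_left_mono mult_pos_pos) linarith+
    also have "\<dots> = 1 / \<delta>\<^sup>2 * (1 + \<bar>real_of_int n\<bar>) powr (-2)"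
      by (simp add: power_mult_distrib powr_minus divide_inverse)
    finally show "norm (1 / (z + of_int n)\<^sup>2) \<le> 1 / \<delta>\<^sup>2 * (1 + \<bar>real_of_int n\<bar>) powr (-2)"
      by (simp add: norm_divide norm_power)
  qed
qed

text \<open>The halves n >= 0 and n < 0 are the trigamma series at z and at 1 - z, so the trigamma
  reflection formula evaluates their sum.\<close>

lemma has_sum_csc2:
  assumes z: "Im z \<noteq> 0"
  shows "((\<lambda>n::int. 1 / (z + of_int n)\<^sup>2) has_sum csc2 z) UNIV"
proof -
  define f where "f = (\<lambda>n::int. 1 / (z + of_int n)\<^sup>2)"
  have sm: "f summable_on A" for A
    by (rule summable_on_subset_banach[OF abs_summable_summable])
       (use abs_summable_inverse_square_int[OF z] in \<open>auto simp: f_def\<close>)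
  have sr: "(f \<circ> h) summable_on UNIV" if "inj h" for h :: "nat \<Rightarrow> int"
    using sm[of "range h"] that by (subst summable_on_reindex[symmetric]) auto
  have "z \<noteq> 0" "1 - z \<noteq> 0" using z by auto
  note P = Polygamma_LIMSEQ[OF this(1), of 1] Polygamma_LIMSEQ[OF this(2), of 1]
  have "((\<lambda>n. f (int n)) has_sum Polygamma 1 z) UNIV"
  proof -
    have s: "(\<lambda>n. f (int n)) summable_on UNIV" using sr[of int] by (simp add: o_def)
    have "(\<lambda>n. f (int n)) sums Polygamma 1 z"
      using P(1) by (simp add: f_def numeral_2_eq_2 divide_inverse)
    thus ?thesis using s by (metis has_sum_imp_sums has_sum_infsum sums_unique2)
  qed
  moreover have "((\<lambda>n. f (- int (Suc n))) has_sum Polygamma 1 (1 - z)) UNIV"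
  proof -
    have s: "(\<lambda>n. f (- int (Suc n))) summable_on UNIV"
      using sr[of "\<lambda>n. - int (Suc n)"] by (simp add: o_def inj_on_def)
    have "f (- int (Suc n)) = inverse ((1 - z + of_nat n) ^ Suc 1)" for n
    proof -
      have "(z + of_int (- int (Suc n)))\<^sup>2 = (1 - z + of_nat n)\<^sup>2"
        by (simp add: power2_eq_square algebra_simps)
      hence "f (- int (Suc n)) = inverse ((1 - z + of_nat n)\<^sup>2)"
        unfolding f_def divide_inverse by (simp only: mult_1)
      thus ?thesis by (simp add: numeral_2_eq_2)
    qed
    hence "(\<lambda>n. f (- int (Suc n))) sums Polygamma 1 (1 - z)"
      using P(2) by simp
    thus ?thesis using s by (metis has_sum_imp_sums has_sum_infsum sums_unique2)
  qed
  ultimately show ?thesis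
    unfolding f_def[symmetric] Polygamma_1_reflection[OF z, symmetric] by (rule has_sum_int_halves)
qed

lemma cot_partial_fractions:
  assumes z: "Im z \<noteq> 0"
  shows "(\<lambda>k. 1 / (z - of_nat (Suc k)) + 1 / (z + of_nat (Suc k))) sums
           (of_real pi * cot (of_real pi * z) - 1 / z)"
proof -
  have nz: "z \<noteq> 0" "1 - z \<noteq> 0" using z by auto
  have "(\<lambda>n. inverse (of_nat (Suc n)) - inverse (z + of_nat n)) sums (Digamma z + euler_mascheroni)"
    "(\<lambda>n. inverse (of_nat (Suc n)) - inverse (1 - z + of_nat n)) sums (Digamma (1 - z) + euler_mascheroni)"
    using summable_Digamma[OF nz(1)] summable_Digamma[OF nz(2)] by (auto simp: Digamma_def summable_sums)
  from sums_diff[OF this(2,1)]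
  have 1: "(\<lambda>n. inverse (z + of_nat n) - inverse (1 - z + of_nat n)) sums (of_real pi * cot (of_real pi * z))"
    using arg_cong[OF Digamma_reflection[OF z], of uminus] by simp
  \<comment> \<open>The digamma series pairs 1/(z + n) with 1/(z - (n + 1)). Adding this telescoping
    series shifts the first of them by one, so that k is paired with -k, and contributes the term
    -1/z.\<close>
  have 2: "(\<lambda>n. inverse (z + of_nat (Suc n)) - inverse (z + of_nat n)) sums
                       (0 - inverse (z + of_nat 0))"
    by (intro telescope_sums filterlim_compose[OF tendsto_inverse_0]
              tendsto_add_filterlim_at_infinity[OF tendsto_const] tendsto_of_nat)
  have "inverse (z + of_nat n) - inverse (1 - z + of_nat n) + (inverse (z + of_nat (Suc n)) - inverse (z + of_nat n))
      = 1 / (z - of_nat (Suc n)) + 1 / (z + of_nat (Suc n))" for n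
  proof -
    have "1 - z + of_nat n = - (z - of_nat (Suc n))" by simp
    hence "inverse (1 - z + of_nat n) = - inverse (z - of_nat (Suc n))"
      by (metis inverse_minus_eq)
    thus ?thesis by (simp add: divide_inverse)
  qed
  with sums_add[OF 1 2] have "(\<lambda>k. 1 / (z - of_nat (Suc k)) + 1 / (z + of_nat (Suc k))) sums
      (of_real pi * cot (of_real pi * z) + (0 - inverse (z + of_nat 0)))" by (simp only:)
  thus ?thesis by (simp add: divide_inverse)
qed

lemma cot_tendsto_i:
  assumes "Im z < 0"
  shows "(\<lambda>N. cot (of_real pi * (of_nat N * z))) \<longlonglongrightarrow> \<i>"
proof -
  define p where "p = exp (- (2 * of_real pi * \<i> * z))"
  have p: "norm p < 1" using assms by (simp add: p_def mult_pos_neg)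
  \<comment> \<open>At N = 0 both sides are quotients by zero, hence 0, so no case distinction is
    needed.\<close>
  have eq: "cot (of_real pi * (of_nat N * z)) = \<i> * (1 + p ^ N) / (1 - p ^ N)" for N
  proof -
    define u where "u = exp (\<i> * (of_real pi * (of_nat N * z)))"
    have u: "u \<noteq> 0" "exp (- (\<i> * (of_real pi * (of_nat N * z)))) = inverse u"
      by (auto simp: u_def exp_minus)
    have "u^2 * p ^ N = 1"
      by (simp add: u_def p_def algebra_simps flip: exp_of_nat_mult exp_add exp_double)
    hence pe: "p ^ N = (inverse u)^2" using u(1) by (simp add: field_simps)
    have "cot (of_real pi * (of_nat N * z)) = ((u + inverse u) / 2) / ((u - inverse u) / (2 * \<i>))"
      unfolding cot_def cos_exp_eq sin_exp_eq by (simp add: u(2) u_def)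
    also have "\<dots> = \<i> * (u + inverse u) / (u - inverse u)" by (simp add: divide_simps)
    also have "\<dots> = \<i> * (u * (1 + (inverse u)\<^sup>2)) / (u * (1 - (inverse u)\<^sup>2))"
    proof -
      have "u * (1 + (inverse u)\<^sup>2) = u + inverse u" "u * (1 - (inverse u)\<^sup>2) = u - inverse u"
        using u(1) by (simp_all add: field_simps power2_eq_square)
      thus ?thesis by simp
    qed
    also have "\<dots> = \<i> * (1 + p ^ N) / (1 - p ^ N)" using u(1) pe by simp
    finally show ?thesis .
  qed
  have "(\<lambda>N. \<i> * (1 + p ^ N) / (1 - p ^ N)) \<longlonglongrightarrow> \<i> * (1 + 0) / (1 - 0)"
    by (intro tendsto_intros LIMSEQ_power_zero p) auto
  thus ?thesis by (simp add: eq)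
qed

lemma csc2_minus: "csc2 (- z) = csc2 z"
  by (simp add: csc2_def)

text \<open>The form q / (1 - q)^2 is the one that occurs termwise in the Lambert series for the
  divisor sums.\<close>

lemma csc2_exp:
  assumes "Im z \<noteq> 0"
  defines "q \<equiv> exp (2 * of_real pi * \<i> * z)"
  shows "csc2 z = - 4 * of_real pi ^ 2 * (q / (1 - q)\<^sup>2)"
proof -
  define u where "u = exp (\<i> * (of_real pi * z))"
  have u: "u \<noteq> 0" "exp (- (\<i> * (of_real pi * z))) = inverse u" "u\<^sup>2 = q"
    by (auto simp: u_def exp_minus q_def algebra_simps simp flip: exp_double)
  have s: "sin (complex_of_real pi * z) = (u - inverse u) / (2 * \<i>)"
    unfolding sin_exp_eq by (simp add: u(2) u_def)
  have "(of_real pi / sin (complex_of_real pi * z))\<^sup>2 = of_real pi ^ 2 / (sin (complex_of_real pi * z))\<^sup>2"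
    by (simp add: power_divide)
  also have "(sin (complex_of_real pi * z))\<^sup>2 = - ((u - inverse u)\<^sup>2 / 4)"
    unfolding s by (simp add: power_divide power_mult_distrib)
  also have "(u - inverse u)\<^sup>2 = (1 - q)\<^sup>2 / q"
    using u(1) by (simp flip: u(3) add: field_simps power2_eq_square)
  finally show ?thesis by (simp add: csc2_def)
qed

lemma has_sum_nonzero_int_imp_sums:
  fixes f :: "int \<Rightarrow> complex"
  assumes "(f has_sum S) (- {0})"
  shows "(\<lambda>k. f (int (Suc k)) + f (- int (Suc k))) sums S"
proof -
  have sr: "(\<lambda>n. f (h n)) summable_on UNIV" if "inj h" "range h \<subseteq> - {0}" for h :: "nat \<Rightarrow> int"
  proof -
    have "f summable_on range h"
      using summable_on_subset_banach[OF has_sum_imp_summable[OF assms] that(2)] .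
    thus ?thesis using that(1) by (subst (asm) summable_on_reindex) (auto simp: o_def)
  qed
  have "(\<lambda>n. f (int (Suc n))) summable_on UNIV" "(\<lambda>n. f (- int (Suc n))) summable_on UNIV"
    by (rule sr; force simp: inj_on_def)+
  then obtain a b where ab: "((\<lambda>n. f (int (Suc n))) has_sum a) UNIV" "((\<lambda>n. f (- int (Suc n))) has_sum b) UNIV"
    unfolding summable_on_def by blast
  hence "(f has_sum (a + b)) (- {0})" by (rule has_sum_nonzero_int_halves)
  hence "S = a + b" using assms has_sum_unique by blast
  thus ?thesis using has_sum_imp_sums[OF has_sum_add[OF ab]] by simp
qed

lemma has_sum_finite_sum:
  fixes f :: "'i \<Rightarrow> 'a \<Rightarrow> complex"
  assumes "finite I" "\<And>i. i \<in> I \<Longrightarrow> (f i has_sum S i) A"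
  shows "((\<lambda>x. \<Sum>i\<in>I. f i x) has_sum (\<Sum>i\<in>I. S i)) A"
  using assms by (induction I rule: finite_induct) (auto intro!: has_sum_add)

section \<open>Divisor sums and their Lambert series\<close>

lemma divisor_sigma_Suc_le: "divisor_sigma (Suc n) \<le> (\<Sum>i\<le>n. Suc i)"
proof -
  have "divisor_sigma (Suc n) \<le> \<Sum>{1..Suc n}"
    unfolding divisor_sigma_def
  proof (rule sum_mono2)
    show "{d. d dvd Suc n} \<subseteq> {1..Suc n}"
      using dvd_imp_le[of _ "Suc n"] by (auto simp: Suc_le_eq intro!: Nat.gr0I)
  qed auto
  also have "\<dots> = (\<Sum>i\<le>n. Suc i)"
    using sum.atLeast_Suc_atMost_Suc_shift[of "\<lambda>x. x" 0 n] by (simp add: atLeast0AtMost o_def)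
  finally show ?thesis .
qed

text \<open>The triangular numbers that bound the divisor sums are the coefficients of the Cauchy
  product of the geometric series with its derivative.\<close>

lemma summable_divisor_sigma:
  fixes r :: real
  assumes r: "0 \<le> r" "r < 1"
  shows "summable (\<lambda>n. real (divisor_sigma (Suc n)) * r ^ n)"
proof -
  have "summable (\<lambda>k. \<Sum>i\<le>k. (of_nat (Suc i) * r ^ i) * r ^ (k - i))"
  proof (rule summable_Cauchy_product)
    show "summable (\<lambda>k. norm (of_nat (Suc k) * r ^ k))"
      using geometric_deriv_sums[of r] r by (auto simp: sums_iff norm_mult)
    show "summable (\<lambda>k. norm (r ^ k))" using r by (simp add: summable_geometric)
  qed
  also have "(\<lambda>k. \<Sum>i\<le>k. (of_nat (Suc i) * r ^ i) * r ^ (k - i)) = (\<lambda>k. real (\<Sum>i\<le>k. Suc i) * r ^ k)"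
  proof
    fix k
    have "(\<Sum>i\<le>k. (of_nat (Suc i) * r ^ i) * r ^ (k - i)) = (\<Sum>i\<le>k. of_nat (Suc i) * r ^ k)"
      by (intro sum.cong) (auto simp flip: power_add)
    thus "(\<Sum>i\<le>k. (of_nat (Suc i) * r ^ i) * r ^ (k - i)) = real (\<Sum>i\<le>k. Suc i) * r ^ k"
      by (simp only: of_nat_sum sum_distrib_right)
  qed
  finally have sm: "summable (\<lambda>k. real (\<Sum>i\<le>k. Suc i) * r ^ k)" .
  show ?thesis
  proof (rule summable_comparison_test[OF exI sm], intro allI impI)
    fix n
    show "norm (real (divisor_sigma (Suc n)) * r ^ n) \<le> real (\<Sum>i\<le>n. Suc i) * r ^ n"
      using divisor_sigma_Suc_le[of n] r
      by (simp del: of_nat_sum sum.atMost_Suc add: mult_right_mono)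
  qed
qed

text \<open>Separating the power series in q from the exponential makes power series holomorphy and
  Cauchy estimates in the q-disc available.\<close>

definition sigma_series :: "complex \<Rightarrow> complex" where
  "sigma_series q = (\<Sum>n. of_nat (divisor_sigma (Suc n)) * q ^ Suc n)"

lemma norm_summable_sigma_series:
  fixes q :: complex
  assumes "norm q < 1"
  shows "summable (\<lambda>n. norm (of_nat (divisor_sigma (Suc n)) * q ^ Suc n))"
proof -
  have "summable (\<lambda>n. norm q * (real (divisor_sigma (Suc n)) * norm q ^ n))"
    using assms by (intro summable_mult summable_divisor_sigma) auto
  thus ?thesis by (simp add: norm_mult norm_power mult_ac)
qed

text \<open>The sum of d q^(n+1) over pairs with d dvd n+1 is taken in two orders: grouped by n it
  gives the divisor sums, grouped by the cofactor of d it gives derivatives of geometric series.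
  Absolute convergence justifies the exchange.\<close>

lemma sigma_series_Lambert:
  assumes q: "norm q < 1"
  shows "((\<lambda>m. q ^ Suc m / (1 - q ^ Suc m)\<^sup>2) has_sum sigma_series q) UNIV"
proof -
  define f where "f = (\<lambda>(n, d). of_nat d * q ^ Suc n)"
  define D where "D = (\<lambda>n. {d. d dvd Suc n})"
  have fin: "finite (D n)" for n by (simp add: D_def)
  have inner: "((\<lambda>d. f (n, d)) has_sum (of_nat (divisor_sigma (Suc n)) * q ^ Suc n)) (D n)" for n
    using fin[of n] by (intro has_sum_finiteI) (auto simp: f_def D_def divisor_sigma_def sum_distrib_right)
  have "(\<lambda>x. norm (f x)) summable_on (Sigma UNIV D)"
    unfolding Infinite_Sum.abs_summable_on_Sigma_iff
  proof (intro conjI ballI)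
    fix n show "(\<lambda>d. norm (f (n, d))) summable_on D n" using fin by simp
  next
    have "(\<Sum>\<^sub>\<infinity>d\<in>D n. norm (f (n, d))) = norm (of_nat (divisor_sigma (Suc n)) * q ^ Suc n)" for n
    proof -
      have "(\<Sum>\<^sub>\<infinity>d\<in>D n. norm (f (n, d))) = (\<Sum>d\<in>D n. real d * norm (q ^ Suc n))"
        using fin by (simp add: f_def norm_mult)
      also have "\<dots> = real (divisor_sigma (Suc n)) * norm (q ^ Suc n)"
        by (simp only: divisor_sigma_def D_def of_nat_sum sum_distrib_right)
      finally show ?thesis by (simp add: norm_mult)
    qed
    thus "(\<lambda>n. norm (\<Sum>\<^sub>\<infinity>d\<in>D n. norm (f (n, d)))) summable_on UNIV"
      using norm_summable_sigma_series[OF q] by (auto intro!: norm_summable_imp_summable_on)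
  qed
  from abs_summable_summable[OF this] obtain S where S: "(f has_sum S) (Sigma UNIV D)"
    by (auto simp: summable_on_def)
  from has_sum_SigmaD[OF this inner]
  have "((\<lambda>n. of_nat (divisor_sigma (Suc n)) * q ^ Suc n) has_sum S) UNIV" .
  hence S_eq: "S = sigma_series q"
    unfolding sigma_series_def using has_sum_imp_sums sums_unique by blast
  \<comment> \<open>(m, k) encodes the factorization n + 1 = (m + 1)(k + 1) with divisor d = k + 1;
    the - 1 undoes the index shift of the series.\<close>
  define h where "h = (\<lambda>(m, k). (Suc m * Suc k - 1, Suc k))"
  have "bij_betw h (UNIV \<times> UNIV) (Sigma UNIV D)"
  proof (rule bij_betwI[where g = "\<lambda>(n, d). (Suc n div d - 1, d - 1)"])
    show "h \<in> UNIV \<times> UNIV \<rightarrow> Sigma UNIV D" by (auto simp: h_def D_def simp del: mult_Suc mult_Suc_right)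
    show "(case h x of (n, d) \<Rightarrow> (Suc n div d - 1, d - 1)) = x" for x
      by (cases x) (simp add: h_def del: mult_Suc mult_Suc_right)
    show "h (case y of (n, d) \<Rightarrow> (Suc n div d - 1, d - 1)) = y" if "y \<in> Sigma UNIV D" for y
    proof -
      obtain n d where y: "y = (n, d)" "d dvd Suc n" using \<open>y \<in> _\<close> by (cases y) (auto simp: D_def)
      then obtain e where e: "Suc n = d * e" by auto
      hence "d > 0" "e > 0" by (auto intro!: Nat.gr0I)
      thus ?thesis using e by (simp add: y h_def mult_ac del: mult_Suc mult_Suc_right)
    qed
  qed auto
  from has_sum_reindex_bij_betw[OF this, of f S] S
  have "((\<lambda>x. f (h x)) has_sum S) (UNIV \<times> UNIV)" by simp
  moreover have "((\<lambda>k. f (h (m, k))) has_sum (q ^ Suc m / (1 - q ^ Suc m)\<^sup>2)) UNIV" for m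
  proof -
    define x where "x = q ^ Suc m"
    have x: "norm x < 1" using q by (simp add: x_def norm_power power_less_one_iff del: power_Suc)
    have eq: "f (h (m, k)) = x * (of_nat (Suc k) * x ^ k)" for k
      by (simp add: f_def h_def x_def mult_ac del: mult_Suc mult_Suc_right of_nat_Suc flip: power_Suc power_mult power_add)
        (simp add: algebra_simps flip: power_add)
    have "summable (\<lambda>k. norm (of_nat (Suc k) * x ^ k))"
      using geometric_deriv_sums[of "norm x"] x by (auto simp: sums_iff norm_mult norm_power simp del: of_nat_Suc)
    moreover have "(\<lambda>k. of_nat (Suc k) * x ^ k) sums (1 / (1 - x)\<^sup>2)"
      using geometric_deriv_sums[OF x] .
    ultimately have "((\<lambda>k. of_nat (Suc k) * x ^ k) has_sum (1 / (1 - x)\<^sup>2)) UNIV"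
      by (rule norm_summable_imp_has_sum)
    from has_sum_cmult_right[OF this, of x] show ?thesis
      unfolding eq x_def[symmetric] by simp
  qed
  ultimately show ?thesis unfolding S_eq by (rule has_sum_SigmaD)
qed

lemma eisenstein_E2_sigma_series:
  "eisenstein_E2 \<tau> = 1 - 24 * sigma_series (exp (2 * of_real pi * \<i> * \<tau>))"
  by (simp add: eisenstein_E2_def sigma_series_def)

lemma norm_nome_less_1: "Im \<tau> > 0 \<Longrightarrow> norm (exp (2 * of_real pi * \<i> * \<tau>)) < 1"
  by simp

text \<open>\<open>csc2\<close> is even, so positive and negative n contribute the same -4 pi^2
  \<open>sigma_series q\<close>. The total -8 pi^2 \<open>sigma_series q\<close> is pi^2/3 times E_2
  - 1 = -24 \<open>sigma_series q\<close>.\<close>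

lemma has_sum_csc2_E2:
  assumes \<tau>: "Im \<tau> > 0"
  shows "((\<lambda>n. csc2 (of_int n * \<tau>)) has_sum (of_real pi ^ 2 / 3 * (eisenstein_E2 \<tau> - 1))) (- {0})"
proof -
  define q where "q = exp (2 * of_real pi * \<i> * \<tau>)"
  define S where "S = - 4 * of_real pi ^ 2 * sigma_series q"
  have *: "csc2 (of_nat (Suc n) * \<tau>) = - 4 * of_real pi ^ 2 * (q ^ Suc n / (1 - q ^ Suc n)\<^sup>2)" for n
  proof -
    have "exp (2 * of_real pi * \<i> * (of_nat (Suc n) * \<tau>)) = q ^ Suc n"
      unfolding q_def exp_of_nat_mult[symmetric] by (simp add: mult_ac)
    thus ?thesis using csc2_exp[of "of_nat (Suc n) * \<tau>"] \<tau> by (simp del: of_nat_Suc power_Suc)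
  qed
  have S: "((\<lambda>n. csc2 (of_nat (Suc n) * \<tau>)) has_sum S) UNIV"
    unfolding * S_def by (intro has_sum_cmult_right sigma_series_Lambert) (use \<tau> in \<open>simp add: q_def\<close>)
  have "((\<lambda>n. csc2 (of_int n * \<tau>)) has_sum (S + S)) (- {0})"
  proof (rule has_sum_nonzero_int_halves)
    show "((\<lambda>n. csc2 (of_int (int (Suc n)) * \<tau>)) has_sum S) UNIV"
      using S by simp
    show "((\<lambda>n. csc2 (of_int (- int (Suc n)) * \<tau>)) has_sum S) UNIV"
      using S csc2_minus[of "of_nat (Suc n) * \<tau>" for n] by (simp del: of_nat_Suc)
  qed
  also have "S + S = of_real pi ^ 2 / 3 * (eisenstein_E2 \<tau> - 1)"
    by (simp add: S_def eisenstein_E2_sigma_series q_def)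
  finally show ?thesis .
qed

lemma has_sum_inverse_squares_int:
  "((\<lambda>n::int. 1 / (of_int n)\<^sup>2) has_sum (of_real pi ^ 2 / 3 :: complex)) (- {0})"
proof -
  have "((\<lambda>n. 1 / (real n + 1)\<^sup>2) has_sum (pi\<^sup>2 / 6)) UNIV"
    using inverse_squares_sums by (intro sums_nonneg_imp_has_sum) (auto simp: add.commute)
  hence S: "((\<lambda>n. complex_of_real (1 / (real n + 1)\<^sup>2)) has_sum complex_of_real (pi\<^sup>2 / 6)) UNIV"
    by (rule has_sum_of_real)
  have "((\<lambda>n::int. 1 / (of_int n)\<^sup>2) has_sum (complex_of_real (pi\<^sup>2 / 6) + complex_of_real (pi\<^sup>2 / 6))) (- {0})"
  proof (rule has_sum_nonzero_int_halves)
    have *: "1 / (of_int (int (Suc n)))\<^sup>2 = complex_of_real (1 / (real n + 1)\<^sup>2)" for n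
      by (simp add: add.commute)
    show "((\<lambda>n. 1 / (of_int (int (Suc n)))\<^sup>2) has_sum complex_of_real (pi\<^sup>2 / 6)) UNIV"
      unfolding * by (rule S)
    have **: "1 / (of_int (- int (Suc n)))\<^sup>2 = complex_of_real (1 / (real n + 1)\<^sup>2)" for n
      unfolding *[symmetric] of_int_minus power2_minus ..
    show "((\<lambda>n. 1 / (of_int (- int (Suc n)))\<^sup>2) has_sum complex_of_real (pi\<^sup>2 / 6)) UNIV"
      unfolding ** by (rule S)
  qed
  thus ?thesis by simp
qed

section \<open>The transformation law\<close>

text \<open>The summand is what remains of 1/x^2, for x = m \<tau> + n, after subtracting 1/x - 1/(x
  + 1). Its cubic decay is enough in two dimensions: both |x| and |x + 1| are at least a constant
  times sqrt ((1 + |m|)(1 + |n|)), so the double series is dominated by a product of two series with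
  exponent 3/2.\<close>

lemma summable_on_lattice_cubes:
  fixes \<tau> :: complex
  assumes \<tau>: "Im \<tau> \<noteq> 0"
  shows "(\<lambda>(m::int, n::int). 1 / ((of_int m * \<tau> + of_int n)\<^sup>2 * (of_int m * \<tau> + of_int n + 1)))
           summable_on (- {0}) \<times> UNIV"
proof -
  obtain \<delta> where \<delta>: "\<delta> > 0" "\<And>m n :: real. cmod (of_real m * \<tau> + of_real n) \<ge> \<delta> * (\<bar>m\<bar> + \<bar>n\<bar>)"
    using lattice_norm_lower_bound[OF \<tau>] by blast
  define p where "p = (\<lambda>n::int. (1 + \<bar>real_of_int n\<bar>) powr (-(3/2)))"
  have p: "p summable_on A" for A
    by (rule summable_on_subset_banach[of _ UNIV]) (use summable_on_int_powr[of "3/2"] in \<open>auto simp: p_def\<close>)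
  have p_nonneg: "p n \<ge> 0" for n by (simp add: p_def)
  have "(\<lambda>(m, n). p m * p n) summable_on (- {0}) \<times> UNIV"
  proof (rule summable_on_SigmaI)
    fix m show "((\<lambda>n. case (m, n) of (m, n) \<Rightarrow> p m * p n) has_sum (p m * infsum p UNIV)) UNIV"
      unfolding prod.case by (intro has_sum_cmult_right has_sum_infsum p)
    show "(\<lambda>m. p m * infsum p UNIV) summable_on - {0}"
      by (intro summable_on_cmult_left p)
  qed (auto simp: p_nonneg)
  from summable_on_cmult_right[OF this, of "1 / (\<delta> / 2) ^ 3"]
  have sm: "(\<lambda>x. 1 / (\<delta> / 2) ^ 3 * (case x of (m, n) \<Rightarrow> p m * p n)) summable_on (- {0}) \<times> UNIV" .
  show ?thesis
  proof (rule abs_summable_summable, rule Infinite_Sum.abs_summable_on_comparison_test'[OF sm])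
    fix mn :: "int \<times> int" assume "mn \<in> (- {0}) \<times> UNIV"
    then obtain m n where mn: "mn = (m, n)" and m: "m \<noteq> 0" by auto
    define x where "x = of_int m * \<tau> + of_int n"
    define P Q where "P = 1 + \<bar>real_of_int m\<bar>" and "Q = 1 + \<bar>real_of_int n\<bar>"
    have PQ: "P > 0" "Q > 0" by (auto simp: P_def Q_def)
    define s where "s = sqrt (P * Q)"
    have s: "s > 0" using PQ by (simp add: s_def)
    have m1: "\<bar>real_of_int m\<bar> \<ge> 1" using m by linarith
    have "s \<le> (P + Q) / 2" unfolding s_def using PQ by (intro arith_geo_mean_sqrt) auto
    \<comment> \<open>The additive 2, and the extra 1 lost in passing from n to n + 1, are absorbed
      by |m| >= 1; this is where the exclusion of m = 0 enters.\<close>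
    hence s2: "2 * s \<le> 2 + \<bar>real_of_int m\<bar> + \<bar>real_of_int n\<bar>" by (simp add: P_def Q_def)
    have "s / 2 \<le> \<bar>real_of_int m\<bar> + \<bar>real_of_int n\<bar>" using s2 m1 s by linarith
    hence "\<delta> * (s / 2) \<le> \<delta> * (\<bar>real_of_int m\<bar> + \<bar>real_of_int n\<bar>)"
      using \<delta>(1) by (intro mult_left_mono) auto
    also have "\<dots> \<le> cmod x" using \<delta>(2)[of "of_int m" "of_int n"] by (simp add: x_def)
    finally have x1: "\<delta> / 2 * s \<le> cmod x" by simp
    have "s / 2 \<le> \<bar>real_of_int m\<bar> + \<bar>real_of_int n + 1\<bar>" using s2 m1 by linarith
    hence "\<delta> * (s / 2) \<le> \<delta> * (\<bar>real_of_int m\<bar> + \<bar>real_of_int n + 1\<bar>)"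
      using \<delta>(1) by (intro mult_left_mono) auto
    also have "\<dots> \<le> cmod (x + 1)" using \<delta>(2)[of "of_int m" "of_int n + 1"] by (simp add: x_def add_ac)
    finally have x2: "\<delta> / 2 * s \<le> cmod (x + 1)" by simp
    have pos: "\<delta> / 2 * s > 0" using \<delta>(1) s by simp
    have "(\<delta> / 2 * s) ^ 3 = (\<delta> / 2 * s)\<^sup>2 * (\<delta> / 2 * s)" by (simp add: eval_nat_numeral)
    also have "\<dots> \<le> (cmod x)\<^sup>2 * cmod (x + 1)"
      using x1 x2 pos by (intro mult_mono power_mono) auto
    finally have le: "(\<delta> / 2 * s) ^ 3 \<le> (cmod x)\<^sup>2 * cmod (x + 1)" .
    moreover have "(\<delta> / 2 * s) ^ 3 > 0" using pos by simp
    ultimately have "1 / ((cmod x)\<^sup>2 * cmod (x + 1)) \<le> 1 / (\<delta> / 2 * s) ^ 3"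
      by (intro frac_le) auto
    also have "\<dots> = 1 / (\<delta> / 2) ^ 3 * (1 / s ^ 3)" by (simp add: power_mult_distrib power_divide)
    also have "1 / s ^ 3 = p m * p n"
    proof -
      have "s ^ 3 = s powr 3" using s by simp
      also have "\<dots> = ((P * Q) powr (1/2)) powr 3" unfolding s_def using PQ by (simp add: powr_half_sqrt)
      also have "\<dots> = P powr (3/2) * Q powr (3/2)"
        unfolding powr_powr using PQ by (simp add: powr_mult)
      finally have "1 / s ^ 3 = P powr (-(3/2)) * Q powr (-(3/2))"
        by (simp add: powr_minus_divide)
      thus ?thesis by (simp only: p_def P_def Q_def)
    qed
    finally show "norm (case mn of (m, n) \<Rightarrow> 1 / ((of_int m * \<tau> + of_int n)\<^sup>2 * (of_int m * \<tau> + of_int n + 1)))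
      \<le> 1 / (\<delta> / 2) ^ 3 * (case mn of (m, n) \<Rightarrow> p m * p n)"
      unfolding mn prod.case x_def[symmetric] by (simp add: norm_divide norm_mult norm_power)
  qed
qed

lemma has_sum_minus:
  fixes f g :: "'a \<Rightarrow> complex"
  assumes "(f has_sum a) A" "(g has_sum b) A"
  shows "((\<lambda>x. f x - g x) has_sum (a - b)) A"
  using has_sum_add[OF assms(1), of "\<lambda>x. - g x" "- b"] assms(2) by (simp add: has_sum_uminus)

lemma sum_int_telescope:
  fixes f :: "int \<Rightarrow> complex"
  shows "(\<Sum>n\<in>{- int N..<int N}. f n - f (n + 1)) = f (- int N) - f (int N)"
proof (induction N)
  case (Suc N)
  have "{- int (Suc N)..<int (Suc N)} = insert (- int (Suc N)) (insert (int N) {- int N..<int N})"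
    by auto
  thus ?case using Suc by (simp add: algebra_simps)
qed auto

theorem eisenstein_E2_inversion:
  assumes \<tau>: "Im \<tau> > 0"
  shows "eisenstein_E2 (- 1 / \<tau>) = \<tau>\<^sup>2 * eisenstein_E2 \<tau> - 6 * \<i> * \<tau> / of_real pi"
proof -
  define x where "x = (\<lambda>m n::int. of_int m * \<tau> + of_int n)"
  define f where "f = (\<lambda>m n::int. 1 / (x m n)\<^sup>2)"
  define a where "a = (\<lambda>m n::int. 1 / x m n - 1 / x m (n + 1))"
  define b where "b = (\<lambda>m n::int. f m n - a m n)"
  define M :: "int set" where "M = - {0}"
  have \<tau>0: "\<tau> \<noteq> 0" using \<tau> by auto
  have Imx: "Im (x m n) = of_int m * Im \<tau>" for m n by (simp add: x_def)
  have x0: "x m n \<noteq> 0" if "m \<in> M" for m n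
    using that \<tau> Imx[of m n] by (auto simp: M_def)
  have b_eq: "b m n = 1 / ((x m n)\<^sup>2 * (x m n + 1))" if "m \<in> M" for m n
  proof -
    have 1: "x m (n + 1) = x m n + 1" by (simp add: x_def)
    have "x m n \<noteq> 0" "x m n + 1 \<noteq> 0" using x0[OF that] 1 by metis+
    hence e: "1 / (x m n)\<^sup>2 = (x m n + 1) / ((x m n)\<^sup>2 * (x m n + 1))"
      "1 / x m n - 1 / (x m n + 1) = x m n / ((x m n)\<^sup>2 * (x m n + 1))"
      by (simp_all add: diff_frac_eq power2_eq_square)
    have "b m n = (x m n + 1) / ((x m n)\<^sup>2 * (x m n + 1)) - x m n / ((x m n)\<^sup>2 * (x m n + 1))"
      unfolding b_def f_def a_def 1 by (simp only: e)
    also have "\<dots> = (x m n + 1 - x m n) / ((x m n)\<^sup>2 * (x m n + 1))"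
      by (rule diff_divide_distrib[symmetric])
    finally show ?thesis by simp
  qed
  have "(\<lambda>(m, n). b m n) summable_on M \<times> UNIV"
  proof (rule summable_on_cong[THEN iffD1])
    show "(\<lambda>(m::int, n::int). 1 / ((of_int m * \<tau> + of_int n)\<^sup>2 * (of_int m * \<tau> + of_int n + 1)))
           summable_on M \<times> UNIV"
      unfolding M_def by (rule summable_on_lattice_cubes) (use \<tau> in auto)
  qed (auto simp: b_eq x_def)
  then obtain B where B: "((\<lambda>(m, n). b m n) has_sum B) (M \<times> UNIV)"
    by (auto simp: summable_on_def)
  have B': "((\<lambda>(n, m). b m n) has_sum B) (UNIV \<times> M)"
    using B by (subst (asm) has_sum_swap) simp
  have b_row: "(\<lambda>n. b m n) summable_on UNIV" if "m \<in> M" for m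
    using summable_on_SigmaD1[OF has_sum_imp_summable[OF B] that] .
  have b_col: "(\<lambda>m. b m n) summable_on M" for n
    using summable_on_SigmaD1[OF has_sum_imp_summable[OF B'], of n] by simp

  \<comment> \<open>In a row the telescoping part collapses to 1/x(m,-N) - 1/x(m,N), which tends to
    0, so \<open>b\<close> has the same row sum as \<open>f\<close>.\<close>
  have rows: "((\<lambda>n. b m n) has_sum csc2 (of_int m * \<tau>)) UNIV" if m: "m \<in> M" for m
  proof -
    have f: "((\<lambda>n. f m n) has_sum csc2 (of_int m * \<tau>)) UNIV"
      unfolding f_def x_def using m \<tau> by (intro has_sum_csc2) (auto simp: M_def)
    obtain b' where b': "((\<lambda>n. b m n) has_sum b') UNIV" using b_row[OF m] by (auto simp: summable_on_def)
    have "((\<lambda>n. a m n) has_sum (csc2 (of_int m * \<tau>) - b')) UNIV"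
      using has_sum_minus[OF f b'] by (simp add: b_def)
    from has_sum_int_imp_LIMSEQ[OF this]
    have "(\<lambda>N. 1 / x m (- int N) - 1 / x m (int N)) \<longlonglongrightarrow> csc2 (of_int m * \<tau>) - b'"
      unfolding a_def by (subst (asm) sum_int_telescope)
    moreover have "(\<lambda>N. 1 / x m (- int N) - 1 / x m (int N)) \<longlonglongrightarrow> 0 - 0"
    proof (intro tendsto_diff)
      have "(\<lambda>N. inverse (of_int m * \<tau> + of_nat N)) \<longlonglongrightarrow> 0"
        by (intro filterlim_compose[OF tendsto_inverse_0]
              tendsto_add_filterlim_at_infinity[OF tendsto_const] tendsto_of_nat)
      thus "(\<lambda>N. 1 / x m (int N)) \<longlonglongrightarrow> 0" by (simp add: x_def divide_inverse)
      have "(\<lambda>N. - inverse (- (of_int m * \<tau>) + of_nat N)) \<longlonglongrightarrow> - 0"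
        by (intro tendsto_minus filterlim_compose[OF tendsto_inverse_0]
              tendsto_add_filterlim_at_infinity[OF tendsto_const] tendsto_of_nat)
      moreover have "- inverse (- (of_int m * \<tau>) + of_nat N) = 1 / x m (- int N)" for N
      proof -
        have "x m (- int N) = - (- (of_int m * \<tau>) + of_nat N)" by (simp add: x_def)
        thus ?thesis by (simp only: divide_inverse inverse_minus_eq mult_1)
      qed
      ultimately show "(\<lambda>N. 1 / x m (- int N)) \<longlonglongrightarrow> 0" by simp
    qed
    ultimately have "csc2 (of_int m * \<tau>) - b' = 0" using LIMSEQ_unique by fastforce
    thus ?thesis using b' by simp
  qed
  have B_eq: "B = of_real pi ^ 2 / 3 * (eisenstein_E2 \<tau> - 1)"
  proof -
    have "((\<lambda>m. csc2 (of_int m * \<tau>)) has_sum B) M"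
      by (rule has_sum_SigmaD[OF B]) (use rows in simp)
    thus ?thesis using has_sum_csc2_E2[OF \<tau>] has_sum_unique unfolding M_def by blast
  qed

  \<comment> \<open>Column sums of \<open>f\<close> over m \<noteq> 0: pulling out \<tau> leaves a
    sum over all integers, from which the term m = 0, namely 1/n^2, is removed; column 0 is the
    Basel sum. The argument is written with -1/\<tau>, allowed by evenness of \<open>csc2\<close>,
    to stay in the upper half plane.\<close>
  define F where "F = (\<lambda>n::int. if n = 0 then of_real pi ^ 2 / 3 / \<tau>\<^sup>2
                        else csc2 (of_int n * (- 1 / \<tau>)) / \<tau>\<^sup>2 - 1 / (of_int n)\<^sup>2)"
  have \<tau>': "Im (- 1 / \<tau>) > 0" using \<tau> by (simp add: Im_divide pos_divide_less_eq sum_power2_gt_zero_iff)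
  have cols: "((\<lambda>m. f m n) has_sum F n) M" for n
  proof (cases "n = 0")
    case True
    have "((\<lambda>m. 1 / (of_int m)\<^sup>2 * (1 / \<tau>\<^sup>2)) has_sum (of_real pi ^ 2 / 3 * (1 / \<tau>\<^sup>2))) M"
      unfolding M_def by (intro has_sum_cmult_left has_sum_inverse_squares_int)
    thus ?thesis using True by (simp add: f_def x_def F_def power_mult_distrib)
  next
    case False
    have "((\<lambda>m. 1 / (of_int n / \<tau> + of_int m)\<^sup>2 * (1 / \<tau>\<^sup>2)) has_sum (csc2 (of_int n / \<tau>) * (1 / \<tau>\<^sup>2))) UNIV"
      using False \<tau>' by (intro has_sum_cmult_left has_sum_csc2) (auto simp: Im_divide)
    also have "(\<lambda>m. 1 / (of_int n / \<tau> + of_int m)\<^sup>2 * (1 / \<tau>\<^sup>2)) = (\<lambda>m. f m n)"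
      using \<tau>0 by (auto simp: f_def x_def field_simps fun_eq_iff simp flip: power_mult_distrib)
    also have "csc2 (of_int n / \<tau>) = csc2 (of_int n * (- 1 / \<tau>))"
      using csc2_minus[of "of_int n / \<tau>"] by simp
    finally have "((\<lambda>m. f m n) has_sum (csc2 (of_int n * (- 1 / \<tau>)) * (1 / \<tau>\<^sup>2))) UNIV" .
    moreover have "((\<lambda>m. f m n) has_sum (f 0 n)) {0}" by (rule has_sum_finiteI) auto
    ultimately have "((\<lambda>m. f m n) has_sum (csc2 (of_int n * (- 1 / \<tau>)) * (1 / \<tau>\<^sup>2) - f 0 n)) (UNIV - {0})"
      by (rule has_sum_Diff) auto
    thus ?thesis using False by (simp add: F_def M_def f_def x_def Compl_eq_Diff_UNIV)
  qed
  define b' where "b' = (\<lambda>n. infsum (\<lambda>m. b m n) M)"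
  have b': "((\<lambda>m. b m n) has_sum b' n) M" for n
    unfolding b'_def by (rule has_sum_infsum[OF b_col])
  have "(b' has_sum B) UNIV" by (rule has_sum_SigmaD[OF B']) (use b' in simp)
  hence lim_b: "(\<lambda>N. \<Sum>n\<in>{- int N..<int N}. b' n) \<longlonglongrightarrow> B" by (rule has_sum_int_imp_LIMSEQ)
  have a_col: "((\<lambda>m. a m n) has_sum (F n - b' n)) M" for n
    using has_sum_minus[OF cols[of n] b'[of n]] by (simp add: b_def)
  \<comment> \<open>The finite sum over n is moved inside the sum over m, where it telescopes.
    Pairing m with -m then yields the partial fractions of the cotangent at N/\<tau>.\<close>
  have strip: "(\<Sum>n\<in>{- int N..<int N}. F n - b' n) =
      - 2 / \<tau> * (of_real pi * cot (of_real pi * (of_nat N * (1 / \<tau>))) - \<tau> / of_nat N)"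
    if N: "N > 0" for N
  proof -
    define t where "t = (\<lambda>m. 1 / x m (- int N) - 1 / x m (int N))"
    have "((\<lambda>m. \<Sum>n\<in>{- int N..<int N}. a m n) has_sum (\<Sum>n\<in>{- int N..<int N}. F n - b' n)) M"
      by (intro has_sum_finite_sum a_col) auto
    also have "(\<lambda>m. \<Sum>n\<in>{- int N..<int N}. a m n) = t"
      unfolding a_def t_def by (subst sum_int_telescope) (rule refl)
    finally have "(\<lambda>k. t (int (Suc k)) + t (- int (Suc k))) sums (\<Sum>n\<in>{- int N..<int N}. F n - b' n)"
      unfolding M_def by (rule has_sum_nonzero_int_imp_sums)
    moreover
    define z where "z = of_nat N / \<tau>"
    have z: "Im z \<noteq> 0" using N \<tau>' by (auto simp: z_def Im_divide)
    have "t (int (Suc k)) + t (- int (Suc k)) =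
        - 2 / \<tau> * (1 / (z - of_nat (Suc k)) + 1 / (z + of_nat (Suc k)))" for k
    proof -
      define K :: complex where "K = of_nat (Suc k)"
      have nz: "z - K \<noteq> 0" "z + K \<noteq> 0" using z by (auto simp: K_def complex_eq_iff)
      have e1: "x (int (Suc k)) (- int N) = - (\<tau> * (z - K))" "x (int (Suc k)) (int N) = \<tau> * (z + K)"
           "x (- int (Suc k)) (- int N) = - (\<tau> * (z + K))" "x (- int (Suc k)) (int N) = \<tau> * (z - K)"
        using \<tau>0 by (auto simp: x_def z_def K_def algebra_simps)
      show ?thesis unfolding t_def e1 K_def[symmetric] using nz \<tau>0 by (simp add: divide_simps)
    qed
    moreover have "(\<lambda>k. - 2 / \<tau> * (1 / (z - of_nat (Suc k)) + 1 / (z + of_nat (Suc k)))) sums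
        (- 2 / \<tau> * (of_real pi * cot (of_real pi * z) - 1 / z))"
      by (intro sums_mult cot_partial_fractions z)
    ultimately have "(\<Sum>n\<in>{- int N..<int N}. F n - b' n) = - 2 / \<tau> * (of_real pi * cot (of_real pi * z) - 1 / z)"
      using sums_unique2 by force
    thus ?thesis by (simp add: z_def)
  qed
  \<comment> \<open>This nonzero limit is the anomaly. Its sign comes from Im (1/\<tau>) < 0, for
    which the cotangent tends to i.\<close>
  have lim_a: "(\<lambda>N. \<Sum>n\<in>{- int N..<int N}. F n - b' n) \<longlonglongrightarrow> - 2 / \<tau> * (of_real pi * \<i> - 0)"
  proof (rule Lim_transform_eventually)
    have "Im (1 / \<tau>) < 0" using \<tau>' by simp
    from cot_tendsto_i[OF this]
    show "(\<lambda>N. - 2 / \<tau> * (of_real pi * cot (of_real pi * (of_nat N * (1 / \<tau>))) - \<tau> / of_nat N))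
       \<longlonglongrightarrow> - 2 / \<tau> * (of_real pi * \<i> - 0)"
      by (intro tendsto_mult tendsto_diff tendsto_const lim_const_over_n)
    show "\<forall>\<^sub>F N in sequentially. - 2 / \<tau> * (of_real pi * cot (of_real pi * (of_nat N * (1 / \<tau>))) - \<tau> / of_nat N)
       = (\<Sum>n\<in>{- int N..<int N}. F n - b' n)"
      using eventually_gt_at_top[of 0] by eventually_elim (simp only: strip)
  qed
  have lim1: "(\<lambda>N. \<Sum>n\<in>{- int N..<int N}. F n) \<longlonglongrightarrow> - 2 / \<tau> * (of_real pi * \<i> - 0) + B"
    using tendsto_add[OF lim_a lim_b] by (simp add: sum_subtractf)

  define E where "E = eisenstein_E2 (- 1 / \<tau>)"
  \<comment> \<open>Second evaluation of the sum of \<open>F\<close>, now through E_2 at -1/\<tau>.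
    The column \<open>F 0\<close> cancels the -1 in \<open>E - 1\<close>, and the Basel constant
    cancels the one in \<open>B\<close>.\<close>
  have "((\<lambda>n. csc2 (of_int n * (- 1 / \<tau>)) * (1 / \<tau>\<^sup>2) - 1 / (of_int n)\<^sup>2) has_sum
          (of_real pi ^ 2 / 3 * (E - 1) * (1 / \<tau>\<^sup>2) - of_real pi ^ 2 / 3)) (- {0})"
    unfolding E_def
    by (intro has_sum_minus has_sum_cmult_left has_sum_csc2_E2 \<tau>' has_sum_inverse_squares_int)
  also have "?this \<longleftrightarrow> (F has_sum (of_real pi ^ 2 / 3 * (E - 1) * (1 / \<tau>\<^sup>2) - of_real pi ^ 2 / 3)) (- {0})"
    by (intro has_sum_cong) (auto simp: F_def)
  finally have "(F has_sum (of_real pi ^ 2 / 3 * (E - 1) / \<tau>\<^sup>2 - of_real pi ^ 2 / 3)) (- {0})" by simp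
  moreover have "(F has_sum F 0) {0}" by (rule has_sum_finiteI) auto
  ultimately have "(F has_sum (of_real pi ^ 2 / 3 * (E - 1) / \<tau>\<^sup>2 - of_real pi ^ 2 / 3 + F 0)) (- {0} \<union> {0})"
    by (rule has_sum_Un_disjoint) auto
  also have "- {0} \<union> {0} = (UNIV :: int set)" by auto
  finally have "(\<lambda>N. \<Sum>n\<in>{- int N..<int N}. F n) \<longlonglongrightarrow>
      of_real pi ^ 2 / 3 * (E - 1) / \<tau>\<^sup>2 - of_real pi ^ 2 / 3 + F 0"
    by (rule has_sum_int_imp_LIMSEQ)
  from LIMSEQ_unique[OF this lim1]
  have "of_real pi ^ 2 / 3 * (E / \<tau>\<^sup>2) = of_real pi ^ 2 / 3 * eisenstein_E2 \<tau> - 2 * of_real pi * \<i> / \<tau>"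
    unfolding B_eq F_def by (simp add: diff_divide_distrib algebra_simps)
  hence "3 / of_real pi ^ 2 * (of_real pi ^ 2 / 3 * (E / \<tau>\<^sup>2)) =
         3 / of_real pi ^ 2 * (of_real pi ^ 2 / 3 * eisenstein_E2 \<tau> - 2 * of_real pi * \<i> / \<tau>)" by simp
  also have "\<dots> = eisenstein_E2 \<tau> - 6 * \<i> / (of_real pi * \<tau>)"
    by (simp add: right_diff_distrib power2_eq_square)
  finally have "E / \<tau>\<^sup>2 = eisenstein_E2 \<tau> - 6 * \<i> / (of_real pi * \<tau>)" by simp
  hence "E = \<tau>\<^sup>2 * (eisenstein_E2 \<tau> - 6 * \<i> / (of_real pi * \<tau>))" using \<tau>0 by (simp add: field_simps)
  also have "\<dots> = \<tau>\<^sup>2 * eisenstein_E2 \<tau> - 6 * \<i> * \<tau> / of_real pi"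
    using \<tau>0 by (simp add: right_diff_distrib power2_eq_square)
  finally show ?thesis by (simp add: E_def)
qed

section \<open>The full modular group, cusps and reduction theory\<close>

lemma eisenstein_E2_periodic: "eisenstein_E2 (z + of_int n) = eisenstein_E2 z"
proof -
  have "exp (2 * of_real pi * \<i> * (z + of_int n)) =
        exp (2 * of_real pi * \<i> * z) * exp (complex_of_real (2 * of_int n * pi) * \<i>)"
    by (simp add: algebra_simps flip: exp_add)
  also have "exp (complex_of_real (2 * of_int n * pi) * \<i>) = 1"
    using exp_integer_2pi[of "of_int n"] by simp
  finally show ?thesis by (simp add: eisenstein_E2_def)
qed

lemma moebius_denominator_nonzero:
  fixes a b c d :: int
  assumes "a * d - b * c = 1" "Im z > 0"
  shows "of_int c * z + of_int d \<noteq> 0"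
proof
  assume *: "of_int c * z + of_int d = 0"
  hence "Im (of_int c * z + of_int d) = 0" by simp
  hence "c = 0" using assms(2) by simp
  thus False using * assms(1) by auto
qed

lemma Im_moebius:
  fixes a b c d :: int
  assumes "a * d - b * c = 1"
  shows "Im ((of_int a * z + of_int b) / (of_int c * z + of_int d)) =
           Im z / (cmod (of_int c * z + of_int d))\<^sup>2"
proof -
  have "Im ((of_int a * z + of_int b) / (of_int c * z + of_int d)) =
     real_of_int (a * d - b * c) * Im z / (cmod (of_int c * z + of_int d))\<^sup>2"
    unfolding Im_divide cmod_power2 by (simp add: algebra_simps)
  thus ?thesis by (simp add: assms)
qed

text \<open>Euclid's algorithm on the first column: the translation by \<open>a div c\<close> and
  one inversion replace the lower left entry c by \<open>a mod c\<close>, so induction on |c| ends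
  at a translation, possibly written with both diagonal entries -1.\<close>

theorem eisenstein_E2_modular:
  fixes a b c d :: int
  assumes "a * d - b * c = 1" and z: "Im z > 0"
  shows "eisenstein_E2 ((of_int a * z + of_int b) / (of_int c * z + of_int d)) =
           (of_int c * z + of_int d)\<^sup>2 * eisenstein_E2 z
             - 6 * \<i> * of_int c * (of_int c * z + of_int d) / of_real pi"
  using assms(1)
proof (induction "nat \<bar>c\<bar>" arbitrary: a b c d rule: less_induct)
  case less
  note det = less.prems
  show ?case
  proof (cases "c = 0")
    case True
    with det have "a = 1 \<and> d = 1 \<or> a = -1 \<and> d = -1" by (simp add: zmult_eq_1_iff)
    thus ?thesis
    proof
      assume "a = 1 \<and> d = 1"
      thus ?thesis using True eisenstein_E2_periodic[of z b] by simp
    next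
      assume *: "a = -1 \<and> d = -1"
      hence "(of_int a * z + of_int b) / (of_int c * z + of_int d) = z + of_int (- b)"
        using True by simp
      thus ?thesis using True * eisenstein_E2_periodic[of z "- b"] by simp
    qed
  next
    case False
    define k r s where "k = a div c" and "r = a mod c" and "s = b - k * d"
    have a: "a = k * c + r" by (simp add: k_def r_def)
    have det': "(- c) * s - (- d) * r = 1" using det by (simp add: a s_def algebra_simps)
    have r: "nat \<bar>r\<bar> < nat \<bar>c\<bar>" using False by (simp add: r_def abs_mod_less)
    define u v where "u = of_int c * z + of_int d" and "v = of_int r * z + of_int s"
    have u: "u \<noteq> 0" unfolding u_def by (rule moebius_denominator_nonzero[OF det z])
    have v: "v \<noteq> 0" unfolding v_def by (rule moebius_denominator_nonzero[OF det' z])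
    define w where "w = (of_int (- c) * z + of_int (- d)) / v"
    have w_eq: "w = - u / v" by (simp add: w_def u_def)
    have Imw: "Im w > 0"
      unfolding w_def v_def Im_moebius[OF det'] using z v by (simp add: v_def)
    have IH: "eisenstein_E2 w = v\<^sup>2 * eisenstein_E2 z - 6 * \<i> * of_int r * v / of_real pi"
      unfolding w_def v_def by (rule less.hyps[OF r det'])
    have "(of_int a * z + of_int b) / u = (of_int k * u + v) / u"
      by (simp add: a s_def u_def v_def algebra_simps)
    also have "\<dots> = - 1 / w + of_int k" using u v by (simp add: w_eq field_simps)
    finally have "eisenstein_E2 ((of_int a * z + of_int b) / u) = eisenstein_E2 (- 1 / w)"
      by (simp only: eisenstein_E2_periodic)
    also have "\<dots> = w\<^sup>2 * (v\<^sup>2 * eisenstein_E2 z - 6 * \<i> * of_int r * v / of_real pi) - 6 * \<i> * w / of_real pi"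
      using eisenstein_E2_inversion[OF Imw] by (simp add: IH)
    also have "\<dots> = (w * v)\<^sup>2 * eisenstein_E2 z - 6 * \<i> / of_real pi * (w * (of_int r * (w * v) + 1))"
      by (simp add: algebra_simps power2_eq_square add_divide_distrib diff_divide_distrib)
    also have "w * v = - u" using v by (simp add: w_eq)
    \<comment> \<open>The two anomaly terms merge into one through the determinant relation,
      substituted for the 1.\<close>
    also have "of_int r * (- u) + 1 = - (of_int c * v)"
    proof -
      have "(1 :: complex) = of_int ((- c) * s - (- d) * r)" by (simp only: det' of_int_1)
      thus ?thesis by (simp add: u_def v_def algebra_simps)
    qed
    also have "w * (- (of_int c * v)) = of_int c * u" using v by (simp add: w_eq)
    finally show ?thesis unfolding u_def[symmetric] power2_minus by (simp add: mult_ac)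
  qed
qed

text \<open>Bezout completes (a, c) to a matrix of determinant 1. With z = w - d/c the denominator c
  z + d is just c w, and the image of z is a/c - 1/(c^2 w). The prefactor c^2 w is nonzero, so zeros
  of E_2 correspond to zeros of the last factor.\<close>

lemma eisenstein_E2_at_cusp:
  fixes a c :: int
  assumes "coprime a c" "c > 0"
  obtains d :: int where
    "\<And>w. Im w > 0 \<Longrightarrow> eisenstein_E2 (of_int a / of_int c - 1 / ((of_int c)\<^sup>2 * w)) =
       (of_int c)\<^sup>2 * w * (w * eisenstein_E2 (w - of_real (d / c)) - 6 * \<i> / of_real pi)"
proof -
  obtain d e where de: "a * d + c * e = 1"
    using assms(1) bezout_int[of a c] by (auto simp: mult.commute)
  define b where "b = - e"
  have det: "a * d - b * c = 1" using de by (simp add: b_def algebra_simps)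
  have "eisenstein_E2 (of_int a / of_int c - 1 / ((of_int c)\<^sup>2 * w)) =
       (of_int c)\<^sup>2 * w * (w * eisenstein_E2 (w - of_real (d / c)) - 6 * \<i> / of_real pi)"
    if w: "Im w > 0" for w
  proof -
    define z where "z = w - of_real (d / c)"
    have c0: "of_int c \<noteq> (0 :: complex)" and w0: "w \<noteq> 0" using assms(2) w by auto
    have z: "Im z > 0" using w by (simp add: z_def)
    have u: "of_int c * z + of_int d = of_int c * w" using c0 by (simp add: z_def algebra_simps)
    have "of_int c * (of_int a * z + of_int b) = of_int a * (of_int c * w) - of_int (a * d - b * c)"
      using c0 by (simp add: z_def algebra_simps)
    hence "of_int a * z + of_int b = of_int a * w - 1 / of_int c"
      unfolding det using c0 by (simp add: field_simps)
    hence "(of_int a * z + of_int b) / (of_int c * z + of_int d) = of_int a / of_int c - 1 / ((of_int c)\<^sup>2 * w)"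
      unfolding u using c0 w0 by (simp add: diff_divide_distrib power2_eq_square)
    from eisenstein_E2_modular[OF det z, unfolded this] show ?thesis
      unfolding u z_def[symmetric] by (simp add: power2_eq_square algebra_simps)
  qed
  thus ?thesis using that by blast
qed

text \<open>A coprime pair (c, d) minimizing |c \<tau> + d| exists because only finitely many pairs
  reach the value 1 of (0, 1) or less. It maximizes the imaginary part over the orbit, and the cusp
  sought is -d/c, or infinity if c = 0.\<close>

lemma modular_reduction:
  assumes \<tau>: "Im \<tau> > 0"
  obtains "Im \<tau> \<ge> 17 / 20"
  | a c :: int where "coprime a c" "c > 0" "Im (- 1 / ((of_int c)\<^sup>2 * (\<tau> - of_int a / of_int c))) \<ge> 17 / 20"
proof -
  obtain \<delta> where \<delta>: "\<delta> > 0" "\<And>m n :: real. cmod (of_real m * \<tau> + of_real n) \<ge> \<delta> * (\<bar>m\<bar> + \<bar>n\<bar>)"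
    using lattice_norm_lower_bound[of \<tau>] \<tau> by auto
  define N where "N = (\<lambda>(c, d). cmod (of_int c * \<tau> + of_int d))"
  define X where "X = {(c :: int, d :: int). coprime c d \<and> N (c, d) \<le> 1}"
  define K where "K = \<lceil>1 / \<delta>\<rceil>"
  have "X \<subseteq> {-K..K} \<times> {-K..K}"
  proof (clarify, goal_cases)
    case (1 c d)
    hence "\<delta> * (\<bar>real_of_int c\<bar> + \<bar>real_of_int d\<bar>) \<le> 1"
      using \<delta>(2)[of "of_int c" "of_int d"] by (simp add: X_def N_def)
    hence "\<bar>real_of_int c\<bar> + \<bar>real_of_int d\<bar> \<le> 1 / \<delta>" using \<delta>(1) by (simp add: field_simps)
    also have "\<dots> \<le> of_int K" by (simp add: K_def)
    finally have "\<bar>c\<bar> + \<bar>d\<bar> \<le> K" by linarith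
    thus ?case by auto
  qed
  hence "finite X" by (rule finite_subset) auto
  moreover have "(0, 1) \<in> X" by (simp add: X_def N_def)
  ultimately obtain p where p: "p \<in> X" "\<And>y. y \<in> X \<Longrightarrow> N p \<le> N y"
    using arg_min_if_finite(1)[of X N] arg_min_least[of X _ N] by blast
  obtain c d where cd: "p = (c, d)" by (cases p)
  have cop: "coprime c d" and N1: "N (c, d) \<le> 1" using p(1) by (auto simp: cd X_def)
  have min: "N (c, d) \<le> N (c', d')" if "coprime c' d'" for c' d'
  proof (cases "N (c', d') \<le> 1")
    case True
    thus ?thesis using p(2)[of "(c', d')"] that by (simp add: cd X_def)
  qed (use N1 in linarith)
  obtain e f where ef: "e * c + f * d = 1"
    using cop bezout_int[of c d] by auto
  define a b where "a = f" and "b = - e"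
  have det: "a * d - b * c = 1" using ef by (simp add: a_def b_def algebra_simps)
  define v where "v = of_int c * \<tau> + of_int d"
  have v: "v \<noteq> 0" unfolding v_def by (rule moebius_denominator_nonzero[OF det \<tau>])
  define z0 where "z0 = (of_int a * \<tau> + of_int b) / v"
  define k where "k = round (Re z0)"
  define z where "z = z0 - of_int k"
  have Re: "\<bar>Re z\<bar> \<le> 1 / 2"
    using of_int_round_abs_le[of "Re z0"] by (simp add: z_def k_def abs_minus_commute)
  have det2: "(a - k * c) * d - (b - k * d) * c = 1" using det by (simp add: algebra_simps)
  have cop2: "coprime (a - k * c) (b - k * d)"
  proof (rule coprimeI)
    fix x assume "x dvd a - k * c" "x dvd b - k * d"
    hence "x dvd (a - k * c) * d - (b - k * d) * c" by simp
    thus "is_unit x" unfolding det2 .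
  qed
  \<comment> \<open>The numerator of \<open>z\<close> is itself a competitor in the minimization,
    hence |z| >= 1; with |Re z| <= 1/2 this gives (Im z)^2 >= 3/4, which exceeds (17/20)^2 =
    0.7225.\<close>
  have "z * v = of_int (a - k * c) * \<tau> + of_int (b - k * d)"
    using v by (simp add: z_def z0_def field_simps) (simp add: v_def algebra_simps)
  hence "cmod v \<le> cmod (z * v)"
    using min[OF cop2] by (simp add: N_def v_def)
  hence "cmod z \<ge> 1" using v by (simp add: norm_mult)
  hence "1 \<le> (cmod z)\<^sup>2" by simp
  moreover have "(Re z)\<^sup>2 \<le> (1 / 2)\<^sup>2" using Re by (subst abs_le_square_iff[symmetric]) simp
  ultimately have Im2: "(Im z)\<^sup>2 \<ge> 3 / 4"
    unfolding cmod_power2 by (simp add: power_divide)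
  have Imz: "Im z = Im \<tau> / (cmod v)\<^sup>2"
    using Im_moebius[OF det, of \<tau>] by (simp add: z_def z0_def v_def)
  have "Im z > 0" unfolding Imz using \<tau> v by simp
  moreover have "(17 / 20)\<^sup>2 \<le> (Im z)\<^sup>2" using Im2 by (simp add: power2_eq_square)
  ultimately have large: "Im z \<ge> 17 / 20" using power2_le_imp_le by force
  \<comment> \<open>The cusp coordinate is -1/(c v), which differs from \<open>z\<close> by a real
    translation only. The two alternatives normalize the denominator of the cusp to be
    positive.\<close>
  have coord: "Im (- 1 / ((of_int c')\<^sup>2 * (\<tau> - of_int a' / of_int c'))) = Im z"
    if "c' \<noteq> 0" "(c' = c \<and> a' = - d) \<or> (c' = - c \<and> a' = d)" for a' c'
  proof -
    have "(of_int c')\<^sup>2 * (\<tau> - of_int a' / of_int c') = of_int c * v"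
      using that by (auto simp: v_def power2_eq_square field_simps)
    moreover have "Im (- 1 / (of_int c * v)) = Im \<tau> / (cmod v)\<^sup>2"
    proof -
      have "- 1 / (of_int c * v) = - cnj v / (of_int c * (v * cnj v))" using v by simp
      also have "\<dots> = - cnj v / of_real (c * (cmod v)\<^sup>2)"
        by (simp only: complex_norm_square[symmetric] of_real_mult of_real_of_int_eq)
      also have "Im \<dots> = Im v / (c * (cmod v)\<^sup>2)" by (simp only: Im_divide_of_real) simp
      finally show ?thesis using that by (auto simp: v_def)
    qed
    ultimately show ?thesis using Imz by simp
  qed
  consider "c = 0" | "c > 0" | "c < 0" by linarith
  thus ?thesis
  proof cases
    case 1
    hence "d = 1 \<or> d = -1" using cop by auto
    hence "cmod v = 1" using 1 by (auto simp: v_def)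
    thus ?thesis using large Imz that(1) by simp
  next
    case 2
    thus ?thesis using cop large coord[of c "- d"] that(2)[of "- d" c] by (simp add: coprime_commute)
  next
    case 3
    thus ?thesis using cop large coord[of "- c" d] that(2)[of d "- c"] by (simp add: coprime_commute)
  qed
qed

section \<open>The fixed point equation\<close>

text \<open>Crude, but it turns every tail into a geometric series of ratio 3r; all radii used later
  are at most 101/1000, well below 1/3.\<close>

lemma divisor_sigma_Suc_le_power: "divisor_sigma (Suc n) \<le> 3 ^ n"
proof -
  have "(\<Sum>i\<le>n. Suc i) \<le> 3 ^ n"
  proof (induction n)
    case (Suc n)
    have "n + 2 \<le> 2 * 3 ^ n" by (induction n) auto
    thus ?case using Suc by simp
  qed auto
  thus ?thesis using divisor_sigma_Suc_le[of n] by linarith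
qed

lemma divisor_sigma_1 [simp]: "divisor_sigma (Suc 0) = 1"
  by (simp add: divisor_sigma_def)

lemma norm_sigma_series_le:
  assumes r: "norm q \<le> r" "r < 1 / 3"
  shows "norm (sigma_series q) \<le> r / (1 - 3 * r)"
    and "norm (sigma_series q - q) \<le> 3 * r\<^sup>2 / (1 - 3 * r)"
proof -
  define f where "f = (\<lambda>n. of_nat (divisor_sigma (Suc n)) * q ^ Suc n)"
  have r0: "r \<ge> 0" using r(1) norm_ge_zero[of q] by linarith
  have f_le: "norm (f n) \<le> r * (3 * r) ^ n" for n
  proof -
    have "norm (f n) = real (divisor_sigma (Suc n)) * norm q ^ Suc n"
      by (simp add: f_def norm_mult norm_power)
    also have "\<dots> \<le> real (3 ^ n) * r ^ Suc n"
      using r(1) divisor_sigma_Suc_le_power[of n] r0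
      by (intro mult_mono power_mono) (auto simp only: of_nat_le_iff norm_ge_zero zero_le_power of_nat_0_le_iff)
    finally show ?thesis by (simp add: power_mult_distrib mult_ac)
  qed
  have g: "(\<lambda>n. r * (3 * r) ^ n) sums (r * (1 / (1 - 3 * r)))"
    using r r0 by (intro sums_mult geometric_sums) auto
  hence gs: "summable (\<lambda>n. r * (3 * r) ^ n)" by (rule sums_summable)
  have "norm (suminf f) \<le> (\<Sum>n. r * (3 * r) ^ n)"
    by (rule norm_suminf_le[OF f_le gs])
  thus "norm (sigma_series q) \<le> r / (1 - 3 * r)"
    using g by (simp add: sums_iff sigma_series_def f_def)
  have "summable f" using summable_norm_comparison_test[OF _ gs, of f] f_le summable_norm_cancel by blast
  hence "sigma_series q - q = (\<Sum>n. f (Suc n))"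
    using suminf_split_head[of f] by (simp add: sigma_series_def f_def)
  moreover have "norm (\<Sum>n. f (Suc n)) \<le> (\<Sum>n. (3 * r) * (r * (3 * r) ^ n))"
  proof (rule norm_suminf_le)
    show "norm (f (Suc n)) \<le> (3 * r) * (r * (3 * r) ^ n)" for n
      using f_le[of "Suc n"] by (simp add: mult_ac)
  qed (rule summable_mult[OF gs])
  moreover have "(\<Sum>n. (3 * r) * (r * (3 * r) ^ n)) = (3 * r) * (r * (1 / (1 - 3 * r)))"
    using sums_mult[OF g, of "3 * r"] by (simp add: sums_iff)
  ultimately show "norm (sigma_series q - q) \<le> 3 * r\<^sup>2 / (1 - 3 * r)"
    by (simp add: power2_eq_square)
qed

lemma holomorphic_sigma_series: "sigma_series holomorphic_on ball 0 1"
proof -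
  have "(\<lambda>q. \<Sum>n. of_nat (divisor_sigma (Suc n)) * q ^ n :: complex) holomorphic_on ball 0 1"
  proof (rule power_series_holomorphic)
    fix q :: complex assume q: "q \<in> ball 0 1"
    have "summable (\<lambda>n. norm (of_nat (divisor_sigma (Suc n)) * q ^ n))"
      using summable_divisor_sigma[of "norm q"] q by (simp add: norm_mult norm_power)
    hence "summable (\<lambda>n. of_nat (divisor_sigma (Suc n)) * q ^ n)" by (rule summable_norm_cancel)
    thus "(\<lambda>n. of_nat (divisor_sigma (Suc n)) * (q - 0) ^ n) sums (\<Sum>n. of_nat (divisor_sigma (Suc n)) * q ^ n)"
      by (simp add: summable_sums)
  qed
  hence "(\<lambda>q. q * (\<Sum>n. of_nat (divisor_sigma (Suc n)) * q ^ n :: complex)) holomorphic_on ball 0 1"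
    by (intro holomorphic_intros)
  moreover have "q * (\<Sum>n. of_nat (divisor_sigma (Suc n)) * q ^ n) = sigma_series q"
    if q: "q \<in> ball 0 1" for q :: complex
  proof -
    have "summable (\<lambda>n. norm (of_nat (divisor_sigma (Suc n)) * q ^ n))"
      using summable_divisor_sigma[of "norm q"] q by (simp add: norm_mult norm_power)
    hence "summable (\<lambda>n. of_nat (divisor_sigma (Suc n)) * q ^ n)" by (rule summable_norm_cancel)
    from suminf_mult[OF this, of q] show ?thesis by (simp add: sigma_series_def mult_ac)
  qed
  ultimately show ?thesis by (rule holomorphic_transform)
qed

text \<open>Cauchy's estimate on a circle of radius 1/10 around q: there the modulus is at most
  0.101, the series at most 0.101/(1 - 0.303) < 3/20, and dividing by the radius gives 3/2.\<close>

lemma norm_deriv_sigma_series_le: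
  assumes q: "norm q \<le> 1 / 1000"
  shows "norm (deriv sigma_series q) \<le> 3 / 2"
proof -
  have cb: "cball q (1 / 10) \<subseteq> ball 0 1"
  proof
    fix x assume "x \<in> cball q (1 / 10)"
    hence "norm (x - q) \<le> 1 / 10" by (simp add: dist_norm norm_minus_commute)
    thus "x \<in> ball 0 1" using q norm_triangle_ineq[of "x - q" q] by simp
  qed
  have "norm ((deriv ^^ 1) sigma_series q) \<le> fact 1 * (3 / 20) / (1 / 10) ^ 1"
  proof (rule Cauchy_inequality)
    show "sigma_series holomorphic_on ball q (1 / 10)"
      using cb ball_subset_cball by (blast intro: holomorphic_on_subset[OF holomorphic_sigma_series])
    show "continuous_on (cball q (1 / 10)) sigma_series"
      by (rule continuous_on_subset[OF holomorphic_on_imp_continuous_on[OF holomorphic_sigma_series] cb])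
    fix x assume "norm (q - x) = 1 / 10"
    hence "norm x \<le> 101 / 1000" using q norm_triangle_ineq4[of q "q - x"] by simp
    from norm_sigma_series_le(1)[OF this] show "norm (sigma_series x) \<le> 3 / 20" by simp
  qed auto
  thus ?thesis by simp
qed

lemma has_field_derivative_eisenstein_E2:
  assumes z: "Im z > 0"
  defines "q \<equiv> exp (2 * of_real pi * \<i> * z)"
  shows "(eisenstein_E2 has_field_derivative (- 24 * (deriv sigma_series q * (q * (2 * of_real pi * \<i>))))) (at z)"
proof -
  have q: "q \<in> ball 0 1" using norm_nome_less_1[OF z] by (simp add: q_def)
  have "(sigma_series has_field_derivative deriv sigma_series q) (at q)"
    by (rule holomorphic_derivI[OF holomorphic_sigma_series _ q]) auto
  moreover have "((\<lambda>z. exp (2 * of_real pi * \<i> * z)) has_field_derivative q * (2 * of_real pi * \<i>)) (at z)"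
    unfolding q_def by (auto intro!: derivative_eq_intros)
  ultimately have "((\<lambda>z. sigma_series (exp (2 * of_real pi * \<i> * z))) has_field_derivative
      deriv sigma_series q * (q * (2 * of_real pi * \<i>))) (at z)"
    unfolding q_def by (rule DERIV_chain2)
  from DERIV_diff[OF DERIV_const[of 1] DERIV_cmult[OF this, of 24]]
  show ?thesis unfolding eisenstein_E2_sigma_series[abs_def] by simp
qed

lemma holomorphic_eisenstein_E2: "eisenstein_E2 holomorphic_on {z. Im z > 0}"
proof -
  have "open {z. Im z > 0}" by (rule open_halfspace_Im_gt)
  thus ?thesis using has_field_derivative_eisenstein_E2 by (auto simp: holomorphic_on_open)
qed

section \<open>Numerical bounds for the nome and for E_2\<close>

lemma exp_1_ge: "exp 1 \<ge> (2718 / 1000 :: real)"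
proof -
  have "(\<Sum>k<8. (1::real) ^ k /\<^sub>R fact k) \<le> exp 1"
    unfolding exp_def by (intro sum_le_suminf summable_exp_generic) auto
  thus ?thesis by (simp add: eval_nat_numeral fact_Suc)
qed

lemma exp_ge_power: "exp (real n) \<ge> (2718 / 1000) ^ n"
  using power_mono[OF exp_1_ge, of n] by (simp flip: exp_of_nat_mult)

lemma norm_nome: "norm (exp (2 * of_real pi * \<i> * z)) = exp (- (2 * pi * Im z))"
  by simp

lemma norm_E2_minus_1_le:
  assumes "norm (exp (2 * of_real pi * \<i> * z)) \<le> r" "r < 1 / 3"
  shows "norm (eisenstein_E2 z - 1) \<le> 24 * (r / (1 - 3 * r))"
  using norm_sigma_series_le(1)[OF assms] by (simp add: eisenstein_E2_sigma_series norm_mult)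

text \<open>The nome is at most 1/125 in modulus, and 24/(125 - 3) < 1/5.\<close>

lemma norm_E2_minus_1_le_fifth:
  assumes "Im z \<ge> 17 / 20"
  shows "norm (eisenstein_E2 z - 1) \<le> 1 / 5"
proof -
  have "real 5 \<le> 2 * 3.1 * (17 / 20)" by simp
  also have "\<dots> \<le> 2 * pi * Im z" using assms pi_approx by (intro mult_mono) auto
  finally have "exp (real 5) \<le> exp (2 * pi * Im z)" by simp
  moreover have "(125 :: real) \<le> (2718 / 1000) ^ 5" by (simp add: eval_nat_numeral)
  ultimately have "125 \<le> exp (2 * pi * Im z)" using exp_ge_power[of 5] by linarith
  hence "norm (exp (2 * of_real pi * \<i> * z)) \<le> 1 / 125"
    unfolding norm_nome exp_minus by (simp add: field_simps)
  from norm_E2_minus_1_le[OF this] show ?thesis by simp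
qed

text \<open>2800 suffices for both uses: 24/2797 < 1/100 bounds E_2 - 1, and 24 (3/2) 6.4 / 2800 <
  1/10 bounds the derivative of E_2.\<close>

lemma norm_nome_le_2800:
  assumes "Im z \<ge> 7 / 5"
  shows "norm (exp (2 * of_real pi * \<i> * z)) \<le> 1 / 2800"
proof -
  have "real 8 \<le> 2 * 3.1 * (7 / 5)" by simp
  also have "\<dots> \<le> 2 * pi * Im z" using assms pi_approx by (intro mult_mono) auto
  finally have "exp (real 8) \<le> exp (2 * pi * Im z)" by simp
  moreover have "(2800 :: real) \<le> (2718 / 1000) ^ 8" by (simp add: eval_nat_numeral)
  ultimately have "2800 \<le> exp (2 * pi * Im z)" using exp_ge_power[of 8] by linarith
  thus ?thesis unfolding norm_nome exp_minus by (simp add: field_simps)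
qed

lemma norm_E2_minus_1_le_hundredth:
  assumes "Im z \<ge> 7 / 5"
  shows "norm (eisenstein_E2 z - 1) \<le> 1 / 100"
  using norm_E2_minus_1_le[OF norm_nome_le_2800[OF assms]] by simp

lemma norm_deriv_E2_le:
  assumes z: "Im z \<ge> 7 / 5"
  shows "norm (deriv eisenstein_E2 z) \<le> 1 / 10"
proof -
  define q where "q = exp (2 * of_real pi * \<i> * z)"
  have q: "norm q \<le> 1 / 2800" using norm_nome_le_2800[OF z] by (simp only: q_def)
  have "deriv eisenstein_E2 z = - 24 * (deriv sigma_series q * (q * (2 * of_real pi * \<i>)))"
    unfolding q_def by (rule DERIV_imp_deriv[OF has_field_derivative_eisenstein_E2]) (use z in simp)
  hence "norm (deriv eisenstein_E2 z) = 24 * (norm (deriv sigma_series q) * (norm q * (2 * pi)))"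
    by (simp add: norm_mult)
  also have "\<dots> \<le> 24 * (3 / 2 * (1 / 2800 * (2 * 3.2)))"
    using q pi_approx by (intro mult_left_mono mult_mono norm_deriv_sigma_series_le) auto
  finally show ?thesis by simp
qed

text \<open>Since w = 6i/(pi E), 2 pi Im w = 12 Re (1/E). As 2 pi Im w is also minus the logarithm
  of the nome's modulus, a bound for E - 1 yields one for the nome and so a better one for E -
  1.\<close>

lemma Im_fixed_point_bound:
  assumes "w * E = 6 * \<i> / of_real pi" "norm (E - 1) \<le> \<epsilon>" "\<epsilon> < 1"
  shows "\<bar>2 * pi * Im w - 12\<bar> \<le> 12 * (\<epsilon> / (1 - \<epsilon>))"
proof -
  have E: "norm E \<ge> 1 - \<epsilon>" using assms(2) norm_triangle_ineq3[of E 1] by simp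
  hence E0: "E \<noteq> 0" using assms(3) by auto
  have "w = of_real (6 / pi) * (\<i> * inverse E)" using assms(1) E0 by (simp add: field_simps)
  hence "Im w = 6 / pi * Re (inverse E)" by (simp del: of_real_divide inverse_complex.simps)
  hence "Im w = 6 / pi * Re (1 / E)" by (simp only: inverse_eq_divide)
  hence "2 * pi * Im w - 12 = 12 * Re (1 / E - 1)" by simp
  hence "\<bar>2 * pi * Im w - 12\<bar> = 12 * \<bar>Re (1 / E - 1)\<bar>" by (simp only: abs_mult abs_numeral)
  also have "\<dots> \<le> 12 * norm (1 / E - 1)" by (intro mult_left_mono abs_Re_le_cmod) auto
  also have "1 / E - 1 = (1 - E) / E" using E0 by (simp add: field_simps)
  also have "norm \<dots> \<le> \<epsilon> / (1 - \<epsilon>)"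
    unfolding norm_divide using assms(2,3) E order_trans[OF norm_ge_zero assms(2)]
    by (intro frac_le) (auto simp: norm_minus_commute)
  finally show ?thesis by simp
qed

text \<open>With \<epsilon> = 1/5 the deviation from 12 is at most 3, and 9/(2 pi) = 1.43... exceeds
  7/5.\<close>

lemma Im_fixed_point_ge:
  assumes "w * E = 6 * \<i> / of_real pi" "norm (E - 1) \<le> 1 / 5"
  shows "Im w \<ge> 7 / 5"
proof -
  have "2 * pi * Im w \<ge> 9" using Im_fixed_point_bound[OF assms] by simp
  moreover have "2 * pi * (7 / 5) \<le> 9" using pi_approx by simp
  ultimately have "2 * pi * (7 / 5) \<le> 2 * pi * Im w" by linarith
  thus ?thesis by simp
qed

lemma fixed_point_norm_bounds:
  assumes Im: "Im w \<ge> 7 / 5" and eq: "w * eisenstein_E2 (w - of_real x) = 6 * \<i> / of_real pi"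
  shows "75 / 10 ^ 6 < pi / 6 * norm (eisenstein_E2 (w - of_real x) - 1)"
    and "pi / 6 * norm (eisenstein_E2 (w - of_real x) - 1) < 777 / 10 ^ 7"
proof -
  define z where "z = w - of_real x"
  define q where "q = exp (2 * of_real pi * \<i> * z)"
  have Imz: "Im z = Im w" by (simp add: z_def)
  have nq: "norm q = exp (- (2 * pi * Im w))" unfolding q_def norm_nome Imz ..
  note eq' = eq[folded z_def]
  \<comment> \<open>exp 12 = 162754.79...; the width of this bracket, rather than the fixed point
    analysis, dominates the final error.\<close>
  have e12: "exp (12 :: real) \<ge> 162500" using exp_ge_power[of 12] by (simp add: eval_nat_numeral)
  have e12': "exp (12 :: real) \<le> 164100"
  proof -
    have "exp (12 :: real) = exp 1 ^ 12" by (simp flip: exp_of_nat_mult)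
    also have "\<dots> \<le> (272 / 100) ^ 12" using e_less_272 by (intro power_mono) auto
    finally show ?thesis by (simp add: eval_nat_numeral)
  qed
  have "\<bar>2 * pi * Im w - 12\<bar> \<le> 12 * (1 / 100 / (1 - 1 / 100))"
    by (rule Im_fixed_point_bound[OF eq' norm_E2_minus_1_le_hundredth]) (use Im Imz in auto)
  moreover have "12 * (1 / 100 / (1 - 1 / 100)) \<le> (13 / 100 :: real)" by simp
  ultimately have 1: "- (2 * pi * Im w) \<le> 13 / 100 - 12" by linarith
  \<comment> \<open>First round of the bootstrap: 1/100 for |E_2 - 1| improves to 1/5800.\<close>
  have "norm q \<le> exp (13 / 100 - 12)" unfolding nq using 1 by simp
  also have "\<dots> = exp (13 / 100) / exp 12" by (rule exp_diff)
  also have "\<dots> \<le> (1 + 13 / 100 + (13 / 100)\<^sup>2) / 162500"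
    using e12 by (intro frac_le exp_bound) auto
  also have "\<dots> \<le> 1 / 141000" by (simp add: power2_eq_square)
  finally have "norm (eisenstein_E2 z - 1) \<le> 24 * (1 / 141000 / (1 - 3 * (1 / 141000)))"
    unfolding q_def by (rule norm_E2_minus_1_le) simp
  hence "norm (eisenstein_E2 z - 1) \<le> 1 / 5800" by simp
  \<comment> \<open>Second round: 12/5799 < 21/10000 pins the nome between 608 and 617 times
    10^(-8).\<close>
  from Im_fixed_point_bound[OF eq' this]
  have "\<bar>2 * pi * Im w - 12\<bar> \<le> 21 / 10000" by simp
  hence 2: "- (2 * pi * Im w) \<le> 21 / 10000 - 12" "- (21 / 10000) - 12 \<le> - (2 * pi * Im w)" by linarith+
  have "norm q \<le> exp (21 / 10000 - 12)" unfolding nq using 2 by simp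
  also have "\<dots> = exp (21 / 10000) / exp 12" by (rule exp_diff)
  also have "\<dots> \<le> (1 + 21 / 10000 + (21 / 10000)\<^sup>2) / 162500"
    using e12 by (intro frac_le exp_bound) auto
  also have "\<dots> \<le> 617 / 10 ^ 8" by (simp add: power2_eq_square)
  finally have up: "norm q \<le> 617 / 10 ^ 8" .
  have "608 / 10 ^ 8 \<le> (1 + - (21 / 10000)) / (164100 :: real)" by simp
  also have "\<dots> \<le> exp (- (21 / 10000)) / exp 12"
    using e12' by (intro frac_le exp_ge_add_one_self) auto
  also have "\<dots> = exp (- (21 / 10000) - 12)" by (rule exp_diff[symmetric])
  also have "\<dots> \<le> norm q" unfolding nq using 2 by simp
  finally have lo: "608 / 10 ^ 8 \<le> norm q" .
  have gq: "norm (sigma_series q - q) \<le> 1 / 10 ^ 9"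
    using norm_sigma_series_le(2)[OF up] by (simp add: power2_eq_square)
  have g: "607 / 10 ^ 8 \<le> norm (sigma_series q)" "norm (sigma_series q) \<le> 6171 / 10 ^ 9"
    using gq lo up norm_triangle_ineq3[of "sigma_series q" q] by (simp_all add: abs_le_iff)
  \<comment> \<open>The factor is 24 pi / 6. Since \<open>sigma_series q\<close> differs from q by
    at most 10^(-9), the nome bracket transfers to it.\<close>
  have E: "pi / 6 * norm (eisenstein_E2 z - 1) = 4 * pi * norm (sigma_series q)"
    by (simp add: eisenstein_E2_sigma_series q_def norm_mult)
  have "75 / 10 ^ 6 < 4 * 3.14 * (607 / 10 ^ 8 :: real)" by simp
  also have "\<dots> \<le> 4 * pi * norm (sigma_series q)"
    using g(1) pi_approx by (intro mult_mono) auto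
  finally show "75 / 10 ^ 6 < pi / 6 * norm (eisenstein_E2 (w - of_real x) - 1)"
    unfolding z_def[symmetric] E .
  have "4 * pi * norm (sigma_series q) \<le> 4 * 3.142 * (6171 / 10 ^ 9)"
    using g(2) pi_approx by (intro mult_mono) auto
  also have "\<dots> < 777 / 10 ^ 7" by simp
  finally show "pi / 6 * norm (eisenstein_E2 (w - of_real x) - 1) < 777 / 10 ^ 7"
    unfolding z_def[symmetric] E .
qed

text \<open>Banach's theorem is applied on the closed convex half plane Im w >= 7/5, where the
  derivative bound is available. Uniqueness extends to Im w >= 17/20 because \<open>\<Phi>\<close>
  already maps that larger half plane into the smaller one.\<close>

lemma fixed_point_exists_unique:
  fixes x :: real
  shows "\<exists>!w. Im w \<ge> 17 / 20 \<and> w * eisenstein_E2 (w - of_real x) = 6 * \<i> / of_real pi"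
proof -
  define \<Phi> where "\<Phi> = (\<lambda>w. 6 * \<i> / of_real pi / eisenstein_E2 (w - of_real x))"
  define S where "S = {w. Im w \<ge> 7 / 5}"
  have nz: "eisenstein_E2 (w - of_real x) \<noteq> 0" if "Im w \<ge> 17 / 20" for w
    using norm_E2_minus_1_le_fifth[of "w - of_real x"] that by auto
  have fp: "w * eisenstein_E2 (w - of_real x) = 6 * \<i> / of_real pi \<longleftrightarrow> \<Phi> w = w" if "Im w \<ge> 17 / 20" for w
    using nz[OF that] by (auto simp: \<Phi>_def field_simps)
  have \<Phi>: "\<Phi> w \<in> S" if "Im w \<ge> 17 / 20" for w
  proof -
    have "\<Phi> w * eisenstein_E2 (w - of_real x) = 6 * \<i> / of_real pi" using nz[OF that] by (simp add: \<Phi>_def)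
    moreover have "norm (eisenstein_E2 (w - of_real x) - 1) \<le> 1 / 5"
      using that by (intro norm_E2_minus_1_le_fifth) auto
    ultimately show ?thesis unfolding S_def using Im_fixed_point_ge by blast
  qed
  have "\<exists>!w\<in>S. \<Phi> w = w"
  proof (rule Banach_fix[where c = "1 / 4"])
    show "complete S" unfolding S_def complete_eq_closed by (rule closed_halfspace_Im_ge)
    show "S \<noteq> {}" by (auto simp: S_def intro!: exI[of _ "2 * \<i>"])
    show "\<Phi> ` S \<subseteq> S" using \<Phi> by (auto simp: S_def)
    fix u v assume uv: "u \<in> S" "v \<in> S"
    have "norm (\<Phi> u - \<Phi> v) \<le> 1 / 4 * norm (u - v)"
    proof (rule field_differentiable_bound)
      show "convex S" unfolding S_def by (rule convex_halfspace_Im_ge)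
      fix w assume "w \<in> S"
      hence w: "Im w \<ge> 7 / 5" by (simp add: S_def)
      define E where "E = eisenstein_E2 (w - of_real x)"
      define D where "D = deriv eisenstein_E2 (w - of_real x)"
      have E0: "E \<noteq> 0" using nz w by (simp add: E_def)
      have "(eisenstein_E2 has_field_derivative D) (at (w - of_real x))"
        unfolding D_def by (rule holomorphic_derivI[OF holomorphic_eisenstein_E2])
          (use w open_halfspace_Im_gt in auto)
      hence "((\<lambda>w. eisenstein_E2 (w - of_real x)) has_field_derivative D * 1) (at w)"
        by (rule DERIV_chain2) (auto intro!: derivative_eq_intros)
      from DERIV_cmult[OF DERIV_inverse_fun[OF this], of "6 * \<i> / of_real pi"]
      have "(\<Phi> has_field_derivative (- (6 * \<i> / of_real pi) * D / E\<^sup>2)) (at w)"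
        using E0 by (simp add: \<Phi>_def E_def divide_inverse power2_eq_square mult_ac)
      thus "(\<Phi> has_field_derivative (- (6 * \<i> / of_real pi) * deriv eisenstein_E2 (w - of_real x)
              / (eisenstein_E2 (w - of_real x))\<^sup>2)) (at w within S)"
        unfolding D_def E_def by (rule has_field_derivative_at_within)
      \<comment> \<open>The derivative of \<open>\<Phi>\<close> is bounded by (6/pi)(1/10)/0.99^2 <
        1/4.\<close>
      have "norm E \<ge> 99 / 100"
        using norm_E2_minus_1_le_hundredth[of "w - of_real x"] w norm_triangle_ineq3[of E 1] by (simp add: E_def)
      hence "(norm E)\<^sup>2 \<ge> (99 / 100)\<^sup>2" by (intro power_mono) auto
      moreover have "norm D \<le> 1 / 10" unfolding D_def using w by (intro norm_deriv_E2_le) auto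
      moreover have "6 / pi \<le> 2" using pi_gt3 by (simp add: field_simps)
      ultimately have "6 / pi * norm D / (norm E)\<^sup>2 \<le> 2 * (1 / 10) / (99 / 100)\<^sup>2"
        by (intro frac_le mult_mono) auto
      also have "\<dots> \<le> 1 / 4" by (simp add: power2_eq_square)
      finally show "norm (- (6 * \<i> / of_real pi) * deriv eisenstein_E2 (w - of_real x)
              / (eisenstein_E2 (w - of_real x))\<^sup>2) \<le> 1 / 4"
        unfolding D_def[symmetric] E_def[symmetric] by (simp add: norm_mult norm_divide norm_power)
    qed (use uv in auto)
    thus "dist (\<Phi> u) (\<Phi> v) \<le> 1 / 4 * dist u v" by (simp add: dist_norm)
  qed auto
  then obtain w where w: "w \<in> S" "\<Phi> w = w" "\<And>v. v \<in> S \<Longrightarrow> \<Phi> v = v \<Longrightarrow> v = w" by blast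
  show ?thesis
  proof (rule ex1I)
    show "Im w \<ge> 17 / 20 \<and> w * eisenstein_E2 (w - of_real x) = 6 * \<i> / of_real pi"
      using w(1,2) fp[of w] by (simp add: S_def)
    fix v assume v: "Im v \<ge> 17 / 20 \<and> v * eisenstein_E2 (v - of_real x) = 6 * \<i> / of_real pi"
    hence "\<Phi> v = v" using fp by blast
    moreover from this have "v \<in> S" using \<Phi>[of v] v by simp
    ultimately show "v = w" using w(3) by blast
  qed
qed

lemma fixed_point_Im_ge:
  assumes "Im w \<ge> 17 / 20" "w * eisenstein_E2 (w - of_real x) = 6 * \<i> / of_real pi"
  shows "Im w \<ge> 7 / 5"
  by (rule Im_fixed_point_ge[OF assms(2)], rule norm_E2_minus_1_le_fifth) (use assms in simp)

text \<open>The derivative is E + D w. If it vanished, then |E|^2 = |D| |w E| = |D| 6/pi <= 1/5,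
  contradicting |E| >= 99/100.\<close>

lemma fixed_point_derivative:
  assumes "Im w \<ge> 7 / 5" "w * eisenstein_E2 (w - of_real x) = 6 * \<i> / of_real pi"
  obtains D where "((\<lambda>w. w * eisenstein_E2 (w - of_real x)) has_field_derivative D) (at w)" "D \<noteq> 0"
proof -
  define E where "E = eisenstein_E2 (w - of_real x)"
  define D where "D = deriv eisenstein_E2 (w - of_real x)"
  have "(eisenstein_E2 has_field_derivative D) (at (w - of_real x))"
    unfolding D_def by (rule holomorphic_derivI[OF holomorphic_eisenstein_E2])
      (use assms(1) open_halfspace_Im_gt in auto)
  hence "((\<lambda>w. eisenstein_E2 (w - of_real x)) has_field_derivative D * 1) (at w)"
    by (rule DERIV_chain2) (auto intro!: derivative_eq_intros)
  from DERIV_mult[OF DERIV_ident this]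
  have "((\<lambda>w. w * eisenstein_E2 (w - of_real x)) has_field_derivative (E + D * w)) (at w)"
    by (simp add: E_def)
  moreover have "E + D * w \<noteq> 0"
  proof
    assume "E + D * w = 0"
    hence "norm E = norm (D * w)" by (metis add_eq_0_iff norm_minus_cancel)
    have E: "norm E \<ge> 99 / 100"
      using norm_E2_minus_1_le_hundredth[of "w - of_real x"] assms(1) norm_triangle_ineq3[of E 1]
      by (simp add: E_def)
    have D: "norm D \<le> 1 / 10" unfolding D_def using assms(1) by (intro norm_deriv_E2_le) auto
    have "norm w * norm E = 6 / pi"
      using arg_cong[OF assms(2), of norm] by (simp add: E_def norm_mult norm_divide)
    moreover have "norm E * norm E = norm D * (norm w * norm E)"
      using \<open>norm E = norm (D * w)\<close> by (metis mult.assoc norm_mult)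
    ultimately have "norm E * norm E = norm D * (6 / pi)" by simp
    also have "6 / pi \<le> 2" using pi_gt3 by (simp add: field_simps)
    hence "norm D * (6 / pi) \<le> 1 / 10 * 2" using D by (intro mult_mono) auto
    finally have "norm E * norm E \<le> 1 / 5" by simp
    moreover have "99 / 100 * (99 / 100) \<le> norm E * norm E" using E by (intro mult_mono) auto
    ultimately show False by simp
  qed
  ultimately show ?thesis using that by blast
qed

section \<open>The coordinate at a cusp and the Ford discs\<close>

definition cusp_map :: "int \<Rightarrow> int \<Rightarrow> complex \<Rightarrow> complex" where
  "cusp_map a c w = of_int a / of_int c - 1 / ((of_int c)\<^sup>2 * w)"

lemma cusp_map_inverse:
  assumes "c \<noteq> 0" "\<tau> \<noteq> of_int a / of_int c"
  shows "cusp_map a c (- 1 / ((of_int c)\<^sup>2 * (\<tau> - of_int a / of_int c))) = \<tau>"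
  using assms by (simp add: cusp_map_def)

lemma Im_cusp_map_pos:
  assumes "c \<noteq> 0" "Im w > 0"
  shows "Im (cusp_map a c w) > 0"
proof -
  have w: "w \<noteq> 0" using assms by auto
  have "Im (cusp_map a c w) = Im w / ((real_of_int c)\<^sup>2 * (cmod w)\<^sup>2)"
  proof -
    have "1 / ((of_int c)\<^sup>2 * w) = inverse w / of_real ((real_of_int c)\<^sup>2)"
      using assms w by (simp add: field_simps)
    moreover have "of_int a / of_int c = complex_of_real (a / c)" by simp
    ultimately have "cusp_map a c w = of_real (a / c) - inverse w / of_real ((real_of_int c)\<^sup>2)"
      unfolding cusp_map_def by (simp only:)
    hence "Im (cusp_map a c w) = - (Im (inverse w) / (real_of_int c)\<^sup>2)"
      by (simp only: minus_complex.simps Im_complex_of_real Im_divide_of_real diff_0)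
    thus ?thesis by (simp add: cmod_power2)
  qed
  thus ?thesis using assms w by simp
qed

text \<open>With t = \<tau> - a/c, expanding the square turns the disc inequality into c^2 |t|^2 <
  Im t, and the coordinate w = -1/(c^2 t) has Im w = Im t / (c^2 |t|^2).\<close>

lemma ford_disc_iff:
  assumes "c > 0"
  shows "\<tau> \<in> ford_disc a c \<longleftrightarrow> (\<exists>w. Im w > 1 \<and> \<tau> = cusp_map a c w)"
proof -
  define C where "C = real_of_int c"
  have C: "C > 0" using assms by (simp add: C_def)
  define t where "t = \<tau> - of_int a / of_int c"
  have "\<tau> \<in> ford_disc a c \<longleftrightarrow> cmod (t - of_real (1 / (2 * C\<^sup>2)) * \<i>) < 1 / (2 * C\<^sup>2)"
    by (simp add: ford_disc_def dist_norm t_def C_def norm_minus_commute algebra_simps)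
  also have "\<dots> \<longleftrightarrow> (cmod (t - of_real (1 / (2 * C\<^sup>2)) * \<i>))\<^sup>2 < (1 / (2 * C\<^sup>2))\<^sup>2"
    using C by (auto intro!: power_strict_mono dest: power2_less_imp_less)
  also have "(cmod (t - of_real (1 / (2 * C\<^sup>2)) * \<i>))\<^sup>2 = (cmod t)\<^sup>2 - Im t / C\<^sup>2 + (1 / (2 * C\<^sup>2))\<^sup>2"
    unfolding cmod_power2 by (simp add: power2_diff)
  also have "\<dots> < (1 / (2 * C\<^sup>2))\<^sup>2 \<longleftrightarrow> C\<^sup>2 * (cmod t)\<^sup>2 < Im t"
  proof -
    have "(cmod t)\<^sup>2 - Im t / C\<^sup>2 < 0 \<longleftrightarrow> C\<^sup>2 * (cmod t)\<^sup>2 < Im t"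
      using C by (simp add: less_divide_eq mult.commute)
    thus ?thesis by simp
  qed
  finally have 1: "\<tau> \<in> ford_disc a c \<longleftrightarrow> C\<^sup>2 * (cmod t)\<^sup>2 < Im t" .
  have Im: "Im (- 1 / (of_real (C\<^sup>2) * t)) = Im t / (C\<^sup>2 * (cmod t)\<^sup>2)" if "t \<noteq> 0"
  proof -
    have "- 1 / (of_real (C\<^sup>2) * t) = - inverse t / of_real (C\<^sup>2)"
      using C that by (simp add: field_simps)
    also have "Im \<dots> = - Im (inverse t) / C\<^sup>2" by (simp only: Im_divide_of_real uminus_complex.simps)
    finally show ?thesis by (simp add: cmod_power2)
  qed
  show ?thesis
  proof
    assume "\<tau> \<in> ford_disc a c"
    hence lt: "C\<^sup>2 * (cmod t)\<^sup>2 < Im t" using 1 by blast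
    hence t0: "t \<noteq> 0" by auto
    define w where "w = - 1 / (of_real (C\<^sup>2) * t)"
    have "Im w > 1" unfolding w_def Im[OF t0] using lt C t0 by (simp add: field_simps)
    moreover have "cusp_map a c w = \<tau>"
      unfolding w_def t_def C_def using cusp_map_inverse[of c \<tau> a] assms t0 by (simp add: t_def)
    ultimately show "\<exists>w. Im w > 1 \<and> \<tau> = cusp_map a c w" by blast
  next
    assume "\<exists>w. Im w > 1 \<and> \<tau> = cusp_map a c w"
    then obtain w where w: "Im w > 1" "\<tau> = cusp_map a c w" by blast
    have w0: "w \<noteq> 0" using w(1) by auto
    have t: "t = - 1 / (of_real (C\<^sup>2) * w)" by (simp add: t_def w(2) cusp_map_def C_def)
    hence t0: "t \<noteq> 0" using w0 C by simp
    have "- 1 / (of_real (C\<^sup>2) * t) = w" using w0 C by (simp add: t)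
    hence "Im t / (C\<^sup>2 * (cmod t)\<^sup>2) > 1" using Im[OF t0] w(1) by simp
    thus "\<tau> \<in> ford_disc a c" unfolding 1 using C t0 by (simp add: field_simps)
  qed
qed

section \<open>Zeros in Ford discs\<close>

text \<open>Both sides of the transformation law are differentiated at the fixed point. The bracket
  vanishes there, so the product rule leaves c^2 w D on the right, with D from
  \<open>fixed_point_derivative\<close>, while a vanishing derivative of E_2 would make the left
  side 0.\<close>

lemma deriv_eisenstein_E2_nonzero:
  fixes c :: int
  assumes c: "c \<noteq> 0" and w: "Im w \<ge> 7 / 5"
    and fp: "w * eisenstein_E2 (w - of_real x) = 6 * \<i> / of_real pi"
    and law: "\<And>w. Im w > 0 \<Longrightarrow> eisenstein_E2 (cusp_map a c w) =
       (of_int c)\<^sup>2 * w * (w * eisenstein_E2 (w - of_real x) - 6 * \<i> / of_real pi)"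
  shows "deriv eisenstein_E2 (cusp_map a c w) \<noteq> 0"
proof
  assume zero: "deriv eisenstein_E2 (cusp_map a c w) = 0"
  have w0: "w \<noteq> 0" using w by auto
  have "(eisenstein_E2 has_field_derivative 0) (at (cusp_map a c w))"
    unfolding zero[symmetric]
    by (rule holomorphic_derivI[OF holomorphic_eisenstein_E2 open_halfspace_Im_gt])
       (use Im_cusp_map_pos[OF c] w in simp)
  moreover have "(cusp_map a c has_field_derivative (1 / ((of_int c)\<^sup>2 * w\<^sup>2))) (at w)"
    unfolding cusp_map_def[abs_def] using c w0
    by (auto intro!: derivative_eq_intros simp: power2_eq_square)
  ultimately have "((\<lambda>w. eisenstein_E2 (cusp_map a c w)) has_field_derivative 0 * (1 / ((of_int c)\<^sup>2 * w\<^sup>2))) (at w)"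
    by (rule DERIV_chain2)
  hence lhs: "((\<lambda>w. eisenstein_E2 (cusp_map a c w)) has_field_derivative 0) (at w)" by simp
  obtain D where D: "((\<lambda>w. w * eisenstein_E2 (w - of_real x)) has_field_derivative D) (at w)" "D \<noteq> 0"
    using fixed_point_derivative[OF w fp] by blast
  define h where "h = (\<lambda>w. (of_int c)\<^sup>2 * w * (w * eisenstein_E2 (w - of_real x) - 6 * \<i> / of_real pi))"
  have "(h has_field_derivative ((of_int c)\<^sup>2 * (w * eisenstein_E2 (w - of_real x) - 6 * \<i> / of_real pi)
          + (D - 0) * ((of_int c)\<^sup>2 * w))) (at w)"
    unfolding h_def by (intro DERIV_mult DERIV_diff D DERIV_const DERIV_cmult_Id)
  hence "(h has_field_derivative (D * ((of_int c)\<^sup>2 * w))) (at w)" by (simp add: fp)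
  moreover have "(h has_field_derivative 0) (at w)"
    by (rule has_field_derivative_transform_within_open[OF lhs open_halfspace_Im_gt[of 0]])
       (use w law in \<open>auto simp: h_def\<close>)
  ultimately have "D * ((of_int c)\<^sup>2 * w) = 0" by (rule DERIV_unique)
  thus False using D(2) c w0 by simp
qed

lemma simple_zero_eisenstein_E2I:
  assumes "Im \<tau> > 0" "eisenstein_E2 \<tau> = 0" "deriv eisenstein_E2 \<tau> \<noteq> 0"
  shows "simple_zero eisenstein_E2 \<tau>"
proof -
  have an: "eisenstein_E2 analytic_on {\<tau>}"
    using holomorphic_eisenstein_E2 open_halfspace_Im_gt[of 0] assms(1)
    by (auto simp: analytic_at)
  moreover have "zorder eisenstein_E2 \<tau> = 1"
    by (rule zorder_zero_eqI'[OF an]) (use assms in auto)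
  ultimately show ?thesis using assms(2) by (simp add: simple_zero_def)
qed

lemma eisenstein_E2_ford_disc:
  fixes a c :: int
  assumes "coprime a c" and c: "c > 0"
  obtains \<tau> where "\<tau> \<in> ford_disc a c" "eisenstein_E2 \<tau> = 0"
    "\<And>\<tau>'. \<tau>' \<in> ford_disc a c \<Longrightarrow> eisenstein_E2 \<tau>' = 0 \<Longrightarrow> \<tau>' = \<tau>"
    "simple_zero eisenstein_E2 \<tau>"
    "75 / 10 ^ 6 * (1 / real_of_int c ^ 2) < cmod (\<tau> - of_int a / of_int c - of_real pi / (6 * of_int c ^ 2) * \<i>)"
    "cmod (\<tau> - of_int a / of_int c - of_real pi / (6 * of_int c ^ 2) * \<i>) < 777 / 10 ^ 7 * (1 / real_of_int c ^ 2)"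
proof -
  obtain d :: int where law:
    "\<And>w. Im w > 0 \<Longrightarrow> eisenstein_E2 (cusp_map a c w) =
       (of_int c)\<^sup>2 * w * (w * eisenstein_E2 (w - of_real (d / c)) - 6 * \<i> / of_real pi)"
    using eisenstein_E2_at_cusp[OF assms] unfolding cusp_map_def by metis
  define x where "x = real_of_int d / real_of_int c"
  note law = law[folded x_def]
  have zero_iff: "eisenstein_E2 (cusp_map a c w) = 0 \<longleftrightarrow> w * eisenstein_E2 (w - of_real x) = 6 * \<i> / of_real pi"
    if "Im w > 0" for w
    unfolding law[OF that] using c that by auto
  obtain w where w: "Im w \<ge> 17 / 20" "w * eisenstein_E2 (w - of_real x) = 6 * \<i> / of_real pi"
    and uniq: "\<And>v. Im v \<ge> 17 / 20 \<Longrightarrow> v * eisenstein_E2 (v - of_real x) = 6 * \<i> / of_real pi \<Longrightarrow> v = w"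
    using fixed_point_exists_unique[of x] by blast
  have Imw: "Im w \<ge> 7 / 5" by (rule fixed_point_Im_ge[OF w])
  have w0: "w \<noteq> 0" using Imw by auto
  define \<tau> where "\<tau> = cusp_map a c w"
  define E where "E = eisenstein_E2 (w - of_real x)"
  have zero: "eisenstein_E2 \<tau> = 0" unfolding \<tau>_def using zero_iff w Imw by simp
  \<comment> \<open>The fixed point equation gives 1/w = -i pi E / 6, hence \<tau> - a/c = i pi E /
    (6 c^2), and the point i pi / (6 c^2) corresponds to E = 1.\<close>
  have "\<tau> - of_int a / of_int c - of_real pi / (6 * of_int c ^ 2) * \<i> =
        of_real (pi / 6 / (real_of_int c)\<^sup>2) * (\<i> * (E - 1))"
  proof -
    have "- (\<i> * E * of_real pi / 6) * w = - (\<i> * of_real pi / 6) * (w * E)" by simp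
    also have "\<dots> = 1" using w(2) by (simp add: E_def)
    finally have iw: "1 / w = - (\<i> * E * of_real pi / 6)" using w0 by (simp add: divide_eq_eq)
    have "\<tau> - of_int a / of_int c = - ((1 / w) / (of_int c)\<^sup>2)"
      by (simp add: \<tau>_def cusp_map_def)
    also have "\<dots> = \<i> * E * of_real pi / 6 / (of_int c)\<^sup>2" unfolding iw by simp
    finally show ?thesis using c by (simp add: field_simps)
  qed
  hence dist: "cmod (\<tau> - of_int a / of_int c - of_real pi / (6 * of_int c ^ 2) * \<i>) =
      pi / 6 * cmod (E - 1) * (1 / (real_of_int c)\<^sup>2)"
    by (simp add: norm_mult norm_divide norm_power)
  have c2: "1 / (real_of_int c)\<^sup>2 > 0" using c by simp
  show ?thesis
  proof (rule that)
    show "\<tau> \<in> ford_disc a c" unfolding ford_disc_iff[OF c] \<tau>_def using Imw by force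
    show "eisenstein_E2 \<tau> = 0" by (rule zero)
    show "\<tau>' = \<tau>" if \<tau>': "\<tau>' \<in> ford_disc a c" "eisenstein_E2 \<tau>' = 0" for \<tau>'
    proof -
      obtain v where v: "Im v > 1" "\<tau>' = cusp_map a c v"
        using \<tau>'(1) unfolding ford_disc_iff[OF c] by blast
      have "v = w" using v \<tau>'(2) zero_iff[of v] by (intro uniq) auto
      thus ?thesis by (simp add: v \<tau>_def)
    qed
    show "simple_zero eisenstein_E2 \<tau>"
    proof (rule simple_zero_eisenstein_E2I[OF _ zero])
      show "Im \<tau> > 0" unfolding \<tau>_def using Imw c by (intro Im_cusp_map_pos) auto
      show "deriv eisenstein_E2 \<tau> \<noteq> 0" unfolding \<tau>_def
        using c by (intro deriv_eisenstein_E2_nonzero[OF _ Imw w(2) law]) auto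
    qed
    show "75 / 10 ^ 6 * (1 / real_of_int c ^ 2) < cmod (\<tau> - of_int a / of_int c - of_real pi / (6 * of_int c ^ 2) * \<i>)"
      unfolding dist E_def by (rule mult_strict_right_mono[OF fixed_point_norm_bounds(1)[OF Imw w(2)] c2])
    show "cmod (\<tau> - of_int a / of_int c - of_real pi / (6 * of_int c ^ 2) * \<i>) < 777 / 10 ^ 7 * (1 / real_of_int c ^ 2)"
      unfolding dist E_def by (rule mult_strict_right_mono[OF fixed_point_norm_bounds(2)[OF Imw w(2)] c2])
  qed
qed

lemma eisenstein_E2_zero_in_ford_disc:
  assumes \<tau>: "Im \<tau> > 0" and zero: "eisenstein_E2 \<tau> = 0"
  obtains a c :: int where "coprime a c" "c > 0" "\<tau> \<in> ford_disc a c"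
  using modular_reduction[OF \<tau>]
proof cases
  \<comment> \<open>High up in the half plane, at the cusp infinity, |E_2 - 1| <= 1/5 excludes zeros
    outright.\<close>
  case 1
  from norm_E2_minus_1_le_fifth[OF this] show ?thesis using zero by simp
next
  case (2 a c)
  define w where "w = - 1 / ((of_int c)\<^sup>2 * (\<tau> - of_int a / of_int c))"
  have Imw: "Im w \<ge> 17 / 20" using 2(3) by (simp only: w_def)
  have "\<tau> \<noteq> of_int a / of_int c"
  proof
    assume "\<tau> = of_int a / of_int c"
    hence "\<tau> = of_real (a / c)" by simp
    thus False using \<tau> by (metis Im_complex_of_real less_irrefl)
  qed
  hence \<tau>_eq: "cusp_map a c w = \<tau>" unfolding w_def using 2(2) by (intro cusp_map_inverse) auto
  obtain d :: int where
    "\<And>w. Im w > 0 \<Longrightarrow> eisenstein_E2 (of_int a / of_int c - 1 / ((of_int c)\<^sup>2 * w)) =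
       (of_int c)\<^sup>2 * w * (w * eisenstein_E2 (w - of_real (d / c)) - 6 * \<i> / of_real pi)"
    using eisenstein_E2_at_cusp[OF 2(1,2)] by blast
  from this[of w] have "eisenstein_E2 (cusp_map a c w) =
       (of_int c)\<^sup>2 * w * (w * eisenstein_E2 (w - of_real (d / c)) - 6 * \<i> / of_real pi)"
    using Imw by (simp add: cusp_map_def)
  hence "w * eisenstein_E2 (w - of_real (d / c)) = 6 * \<i> / of_real pi"
    using zero 2(2) Imw unfolding \<tau>_eq by auto
  from fixed_point_Im_ge[OF Imw this] have "\<tau> \<in> ford_disc a c"
    unfolding ford_disc_iff[OF 2(2)] using \<tau>_eq by force
  thus ?thesis using that 2 by blast
qed

theorem theorem1p1:
  shows "(\<forall>a c :: int. coprime a c \<and> c > 0 \<longrightarrow>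
            (\<exists>!\<tau>. \<tau> \<in> ford_disc a c \<and> eisenstein_E2 \<tau> = 0) \<and>
            (\<forall>\<tau> \<in> ford_disc a c. eisenstein_E2 \<tau> = 0 \<longrightarrow>
               simple_zero eisenstein_E2 \<tau> \<and>
               0.000075 * (1 / real_of_int c ^ 2)
                 < cmod (\<tau> - of_int a / of_int c - of_real pi / (6 * of_int c ^ 2) * \<i>) \<and>
               cmod (\<tau> - of_int a / of_int c - of_real pi / (6 * of_int c ^ 2) * \<i>)
                 < 0.0000777 * (1 / real_of_int c ^ 2))) \<and>
         (\<forall>\<tau>. Im \<tau> > 0 \<and> eisenstein_E2 \<tau> = 0 \<longrightarrow>
            (\<exists>a c :: int. coprime a c \<and> c > 0 \<and> \<tau> \<in> ford_disc a c))"
proof (intro conjI allI impI)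
  fix a c :: int
  assume "coprime a c \<and> c > 0"
  hence cop: "coprime a c" and c: "c > 0" by auto
  obtain \<tau>0 where \<tau>0: "\<tau>0 \<in> ford_disc a c" "eisenstein_E2 \<tau>0 = 0"
    "\<And>\<tau>. \<tau> \<in> ford_disc a c \<Longrightarrow> eisenstein_E2 \<tau> = 0 \<Longrightarrow> \<tau> = \<tau>0"
    "simple_zero eisenstein_E2 \<tau>0"
    "75 / 10 ^ 6 * (1 / real_of_int c ^ 2) < cmod (\<tau>0 - of_int a / of_int c - of_real pi / (6 * of_int c ^ 2) * \<i>)"
    "cmod (\<tau>0 - of_int a / of_int c - of_real pi / (6 * of_int c ^ 2) * \<i>) < 777 / 10 ^ 7 * (1 / real_of_int c ^ 2)"
    using eisenstein_E2_ford_disc[OF cop c] by blast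
  show "\<exists>!\<tau>. \<tau> \<in> ford_disc a c \<and> eisenstein_E2 \<tau> = 0"
    using \<tau>0(1-3) by blast
  show "\<forall>\<tau> \<in> ford_disc a c. eisenstein_E2 \<tau> = 0 \<longrightarrow>
          simple_zero eisenstein_E2 \<tau> \<and>
          0.000075 * (1 / real_of_int c ^ 2)
            < cmod (\<tau> - of_int a / of_int c - of_real pi / (6 * of_int c ^ 2) * \<i>) \<and>
          cmod (\<tau> - of_int a / of_int c - of_real pi / (6 * of_int c ^ 2) * \<i>)
            < 0.0000777 * (1 / real_of_int c ^ 2)"
  proof (intro ballI impI)
    fix \<tau> assume "\<tau> \<in> ford_disc a c" "eisenstein_E2 \<tau> = 0"
    hence "\<tau> = \<tau>0" by (rule \<tau>0(3))
    thus "simple_zero eisenstein_E2 \<tau> \<and>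
          0.000075 * (1 / real_of_int c ^ 2)
            < cmod (\<tau> - of_int a / of_int c - of_real pi / (6 * of_int c ^ 2) * \<i>) \<and>
          cmod (\<tau> - of_int a / of_int c - of_real pi / (6 * of_int c ^ 2) * \<i>)
            < 0.0000777 * (1 / real_of_int c ^ 2)"
      using \<tau>0(4-6) by simp
  qed
next
  fix \<tau> assume "Im \<tau> > 0 \<and> eisenstein_E2 \<tau> = 0"
  thus "\<exists>a c :: int. coprime a c \<and> c > 0 \<and> \<tau> \<in> ford_disc a c"
    using eisenstein_E2_zero_in_ford_disc by blast
qed

end
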